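(* Let $n\ge 2$ be an integer. There exist rational constants $N^m_{i_1\cdots i_k}\begin{pmatrix} s_1&\ldots&s_m\\ t_1&\ldots&t_m\end{pmatrix}$ (depending on $n$ and on the displayed indices, but not on $v$) such that a formal power series $v\in\mathbb C[[x_1,x_2,\dots]]$ is a solution of the $n$-Gelfand--Dikii hierarchy if and only if for every $k\ge 2$ and all integers $i_1,\dots,i_k\ge 1$ $$\partial_{i_1}\cdots\partial_{i_k}v=\sum_{m=1}^{\infty}\ \sum N^m_{i_1\cdots i_k}\begin{pmatrix} s_1&\ldots&s_m\\ t_1&\ldots&t_m\end{pmatrix}\,\partial_{s_1}\partial^{t_1}v\cdots\partial_{s_m}\partial^{t_m}v ,$$ where the inner sum is over all $2\times m$ integer matrices $\begin{pmatrix} s_1&\ldots&s_m\\ t_1&\ldots&t_m\end{pmatrix}$ such that $1\le s_j<n$ and $t_j\ge 1$ for all $j$, $\sum_{j=1}^k i_j=\sum_{j=1}^m(s_j+t_j)$, $\sum_{j=1}^m t_j\ge m+k-2$, and $k+m+\sum_{j=1}^m t_j\equiv 0\pmod 2$.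
   Context: Functions of $x=(x_1,x_2,\dots)$ are formal power series in $\mathbb C[[x_1,x_2,\dots]]$ (countably many variables); $\partial_i=\partial/\partial x_i$ and $\partial=\partial_1$. For $v\in\mathbb C[[x_1,x_2,\dots]]$ define $\eta_r$ ($r\ge1$) by $$\sum_{r\ge1}\eta_rk^{-r}=v(x)-v\bigl(x_1-k^{-1},x_2-\tfrac12k^{-2},x_3-\tfrac13k^{-3},\dots\bigr),$$ that is, $\eta_r=\sum_{l\ge1}\sum_{i_1+\cdots+i_l=r,\ i_j\ge1}\frac{(-1)^{l+1}}{l!\,i_1\cdots i_l}\partial_{i_1}\cdots\partial_{i_l}v$. Define $\xi_i$ ($i\ge 1$) by $1+\sum_{i\ge1}\xi_ik^{-i}=\exp\bigl(\sum_{r\ge1}\eta_rk^{-r}\bigr)$, and set $\psi(x,k)=\exp\bigl(\sum_{j\ge1}x_jk^j\bigr)\bigl(1+\sum_{i\ge1}\xi_ik^{-i}\bigr)$, where $\partial_l$ acts by $\partial_l(e^{\sum x_jk^j}g)=e^{\sum x_jk^j}(k^l+\partial_l)g$ on formal Laurent series $g$ in $k^{-1}$. $v$ is a solution of the KP hierarchy (with $v=-\ln\tau$) if for every $l\ge1$ there are $B_l^i\in\mathbb C[[x_1,x_2,\dots]]$, $2\le i\le l$, with $\partial_l\psi=L_l\psi$, where $L_l=\partial^l+\sum_{i=2}^lB_l^i\,\partial^{\,l-i}$. $v$ is a solution of the $n$-Gelfand--Dikii hierarchy if it is a solution of the KP hierarchy which does not depend on $x_n$, in the sense that all $\xi_i$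 are independent of $x_n$; equivalently $\partial_m\partial_nv=0$ for all $m\ge1$. (In this case $L=L_n=\partial^n+u_{n-2}\partial^{n-2}+\cdots+u_0$ satisfies the Lax equations $\partial_iL=[[L^{i/n}]_+,L]$, $i\ge1$, where $[\cdot]_+$ is the differential part of a pseudo-differential operator.) *)

theory Defs
  imports
    "HOL-Library.Multiset"
    "HOL-Computational_Algebra.Formal_Laurent_Series"
    Complex_Main
begin

text \<open>
  A monomial in \<open>x\<^sub>1, x\<^sub>2, \<dots>\<close> is a finite multiset of variables and a power series is an
  arbitrary family of coefficients indexed by monomials (so infinite sums such as \<open>\<Sum>j. x\<^sub>j\<close> are
  allowed).  The variable \<open>x\<^sub>i\<close>, \<open>i \<ge> 1\<close>, is encoded by the multiset element \<open>i - 1\<close>, so that there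
  is no variable \<open>x\<^sub>0\<close>.
\<close>

typedef 'a mvps = "UNIV :: (nat multiset \<Rightarrow> 'a) set"
  morphisms mcoeff Abs_mvps ..

setup_lifting type_definition_mvps

lemma mvps_eqI: "(\<And>M. mcoeff f M = mcoeff g M) \<Longrightarrow> f = g"
  by transfer auto

lemma finite_submultisets: "finite {A. A \<subseteq># (M :: 'b multiset)}"
proof (induction M)
  case empty
  then show ?case by simp
next
  case (add x M)
  have "{A. A \<subseteq># add_mset x M} \<subseteq> {A. A \<subseteq># M} \<union> add_mset x ` {A. A \<subseteq># M}"
  proof
    fix A assume "A \<in> {A. A \<subseteq># add_mset x M}"
    then have A: "A \<subseteq># add_mset x M" by simp
    show "A \<in> {A. A \<subseteq># M} \<union> add_mset x ` {A. A \<subseteq># M}"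
    proof (cases "x \<in># A")
      case True
      then obtain B where "A = add_mset x B" by (metis insert_DiffM)
      with A show ?thesis by auto
    next
      case False
      with A show ?thesis by (simp add: inter_add_right1 subset_mset.inf.absorb_iff1)
    qed
  qed
  with add show ?case by (meson finite_UnI finite_imageI finite_subset)
qed

lemma finite_mset_splits: "finite {(A, B). A + B = (M :: 'b multiset)}"
proof -
  have "{(A, B). A + B = M} \<subseteq> {A. A \<subseteq># M} \<times> {A. A \<subseteq># M}"
    by auto
  then show ?thesis
    by (rule finite_subset) (intro finite_cartesian_product finite_submultisets)
qed

instantiation mvps :: (comm_ring_1) comm_ring_1
begin

lift_definition zero_mvps :: "'a mvps" is "\<lambda>_. 0" .
lift_definition one_mvps :: "'a mvps" is "\<lambda>M. if M = {#} then 1 else 0" .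
lift_definition plus_mvps :: "'a mvps \<Rightarrow> 'a mvps \<Rightarrow> 'a mvps" is "\<lambda>f g M. f M + g M" .
lift_definition minus_mvps :: "'a mvps \<Rightarrow> 'a mvps \<Rightarrow> 'a mvps" is "\<lambda>f g M. f M - g M" .
lift_definition uminus_mvps :: "'a mvps \<Rightarrow> 'a mvps" is "\<lambda>f M. - f M" .
lift_definition times_mvps :: "'a mvps \<Rightarrow> 'a mvps \<Rightarrow> 'a mvps"
  is "\<lambda>f g M. \<Sum>(A, B) \<in> {(A, B). A + B = M}. f A * g B" .

instance
proof
  fix f g h :: "'a mvps"
  show "f * g * h = f * (g * h)"
  proof (transfer, rule ext)
    fix f g h :: "nat multiset \<Rightarrow> 'a" and M :: "nat multiset"
    have "(\<Sum>(P, C) \<in> {(P, C). P + C = M}. (\<Sum>(A, B) \<in> {(A, B). A + B = P}. f A * g B) * h C)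
        = (\<Sum>p \<in> {(P, C). P + C = M}. \<Sum>q \<in> {(A, B). A + B = fst p}.
             f (fst q) * g (snd q) * h (snd p))"
      by (simp add: sum_distrib_right case_prod_beta)
    also have "\<dots> = (\<Sum>(p, q) \<in> (SIGMA p : {(P, C). P + C = M}. {(A, B). A + B = fst p}).
             f (fst q) * g (snd q) * h (snd p))"
      by (subst sum.Sigma) (auto intro: finite_mset_splits)
    also have "\<dots> = (\<Sum>(p, q) \<in> (SIGMA p : {(A, P). A + P = M}. {(B, C). B + C = snd p}).
             f (fst p) * (g (fst q) * h (snd q)))"
      by (rule sum.reindex_bij_witness
            [where i = "\<lambda>((A, P), (B, C)). ((A + B, C), (A, B))"
               and j = "\<lambda>((P, C), (A, B)). ((A, B + C), (B, C))"])
         (auto simp: ac_simps)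
    also have "\<dots> = (\<Sum>p \<in> {(A, P). A + P = M}. \<Sum>q \<in> {(B, C). B + C = snd p}.
             f (fst p) * (g (fst q) * h (snd q)))"
      by (subst sum.Sigma) (auto intro: finite_mset_splits)
    also have "\<dots> = (\<Sum>(A, P) \<in> {(A, P). A + P = M}.
             f A * (\<Sum>(B, C) \<in> {(B, C). B + C = P}. g B * h C))"
      by (simp add: sum_distrib_left case_prod_beta)
    finally show "(\<Sum>(P, C) \<in> {(P, C). P + C = M}.
             (\<Sum>(A, B) \<in> {(A, B). A + B = P}. f A * g B) * h C)
        = (\<Sum>(A, P) \<in> {(A, P). A + P = M}.
             f A * (\<Sum>(B, C) \<in> {(B, C). B + C = P}. g B * h C))" .
  qed
  show "f * g = g * f"
  proof (transfer, rule ext)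
    fix f g :: "nat multiset \<Rightarrow> 'a" and M :: "nat multiset"
    show "(\<Sum>(A, B) \<in> {(A, B). A + B = M}. f A * g B) = (\<Sum>(A, B) \<in> {(A, B). A + B = M}. g A * f B)"
      by (rule sum.reindex_bij_witness[where i = prod.swap and j = prod.swap])
         (auto simp: ac_simps)
  qed
  show "1 * f = f"
  proof (transfer, rule ext)
    fix f :: "nat multiset \<Rightarrow> 'a" and M :: "nat multiset"
    have "(\<Sum>(A, B) \<in> {(A, B). A + B = M}. (if A = {#} then 1 else 0) * f B)
        = (\<Sum>(A, B) \<in> {({#} :: nat multiset, M)}. (if A = {#} then 1 else 0) * f B)"
      by (rule sum.mono_neutral_right) (auto intro: finite_mset_splits split: if_splits)
    then show "(\<Sum>(A, B) \<in> {(A, B). A + B = M}. (if A = {#} then 1 else 0) * f B) = f M"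
      by simp
  qed
  show "(f + g) * h = f * h + g * h"
    by transfer (simp add: case_prod_beta distrib_right sum.distrib fun_eq_iff)
  show "(0 :: 'a mvps) \<noteq> 1"
    by transfer (auto simp: fun_eq_iff)
qed (transfer; simp add: fun_eq_iff algebra_simps)+

end

lift_definition mconst :: "'a::zero \<Rightarrow> 'a mvps" is "\<lambda>c M. if M = {#} then c else 0" .

text \<open>\<open>pd i\<close> is \<open>\<partial>\<^sub>i = \<partial>/\<partial>x\<^sub>i\<close>; it is only meant for \<open>i \<ge> 1\<close>.\<close>

lift_definition pd :: "nat \<Rightarrow> 'a::comm_ring_1 mvps \<Rightarrow> 'a mvps"
  is "\<lambda>i f M. of_nat (count M (i - 1) + 1) * f (add_mset (i - 1) M)" .

lemma pd_zero [simp]: "pd i 0 = 0"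
  by transfer simp

lemma pd_add: "pd i (f + g) = pd i f + pd i g"
  by transfer (simp add: fun_eq_iff distrib_left)

lemma pd_commute: "pd i (pd j f) = pd j (pd i f)"
  by transfer (auto simp: fun_eq_iff add_mset_commute)

definition pds :: "nat list \<Rightarrow> 'a::comm_ring_1 mvps \<Rightarrow> 'a mvps" where
  "pds is v = foldr pd is v"

text \<open>
  \<open>eta v r\<close> is the coefficient of \<open>k\<^bsup>-r\<^esup>\<close> in
  \<open>v(x) - v(x\<^sub>1 - k\<^bsup>-1\<^esup>, x\<^sub>2 - k\<^bsup>-2\<^esup>/2, x\<^sub>3 - k\<^bsup>-3\<^esup>/3, \<dots>)\<close>, written out by Taylor's formula.
\<close>

definition compositions :: "nat \<Rightarrow> nat list set" where
  "compositions r = {is. is \<noteq> [] \<and> (\<forall>i \<in> set is. i \<ge> 1) \<and> sum_list is = r}"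

lemma length_le_sum_list: "(\<forall>i \<in> set is. i \<ge> 1) \<Longrightarrow> length is \<le> sum_list (is :: nat list)"
  by (induction "is") auto

lemma finite_compositions: "finite (compositions r)"
proof (rule finite_subset)
  show "compositions r \<subseteq> {is. set is \<subseteq> {..r} \<and> length is \<le> r}"
    unfolding compositions_def using length_le_sum_list member_le_sum_list by fastforce
  show "finite {is. set is \<subseteq> {..r} \<and> length is \<le> r}"
    by (rule finite_lists_length_le) simp
qed

definition eta :: "complex mvps \<Rightarrow> nat \<Rightarrow> complex mvps" where
  "eta v r = (\<Sum>is \<in> compositions r.
     mconst ((-1) ^ (length is + 1) / (fact (length is) * of_nat (prod_list is))) * pds is v)"

text \<open>The formal variable of the power and Laurent series below is \<open>k\<^bsup>-1\<^esup>\<close>.\<close>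

definition eta_series :: "complex mvps \<Rightarrow> complex mvps fps" where
  "eta_series v = Abs_fps (\<lambda>r. if r = 0 then 0 else eta v r)"

text \<open>
  The library's \<open>fps_exp\<close> needs a field of coefficients, hence the exponential series is
  written out here.
\<close>

definition exp_series :: "complex mvps fps" where
  "exp_series = Abs_fps (\<lambda>l. mconst (1 / fact l))"

definition xi :: "complex mvps \<Rightarrow> nat \<Rightarrow> complex mvps" where
  "xi v i = (exp_series oo eta_series v) $ i"

lemma xi_0: "xi v 0 = 1"
  by (simp add: xi_def fps_compose_nth exp_series_def) (transfer, simp)

text \<open>
  A formal expression \<open>exp (\<Sum>j. x\<^sub>j k\<^sup>j) g\<close> with a formal Laurent series \<open>g\<close> in \<open>k\<^bsup>-1\<^esup>\<close> is
  represented by \<open>g\<close>.  Thus \<open>psi v\<close> represents \<open>\<psi>(x, k)\<close>, and \<open>\<partial>\<^sub>l\<close> acts on such an expression by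
  \<open>wave_pd l\<close>, that is, by \<open>k\<^sup>l + \<partial>\<^sub>l\<close> on \<open>g\<close>.
\<close>

definition psi :: "complex mvps \<Rightarrow> complex mvps fls" where
  "psi v = fps_to_fls (Abs_fps (xi v))"

definition fls_pd :: "nat \<Rightarrow> complex mvps fls \<Rightarrow> complex mvps fls" where
  "fls_pd l g = Abs_fls (\<lambda>j. pd l (fls_nth g j))"

lemma fls_pd_nth [simp]: "fls_nth (fls_pd l g) j = pd l (fls_nth g j)"
  unfolding fls_pd_def
  by (rule nth_Abs_fls_ex_lower_bound) (metis fls_eq0_below_subdegree pd_zero)

definition wave_pd :: "nat \<Rightarrow> complex mvps fls \<Rightarrow> complex mvps fls" where
  "wave_pd l g = fls_X_inv ^ l * g + fls_pd l g"

definition KP_solution :: "complex mvps \<Rightarrow> bool" where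
  "KP_solution v \<longleftrightarrow> (\<forall>l \<ge> 1. \<exists>B :: nat \<Rightarrow> complex mvps.
     wave_pd l (psi v) =
       (wave_pd 1 ^^ l) (psi v) + (\<Sum>i = 2..l. fls_const (B i) * (wave_pd 1 ^^ (l - i)) (psi v)))"

definition GD_solution :: "nat \<Rightarrow> complex mvps \<Rightarrow> bool" where
  "GD_solution n v \<longleftrightarrow> KP_solution v \<and> (\<forall>i \<ge> 1. pd n (xi v i) = 0)"

text \<open>
  A \<open>2 \<times> m\<close> matrix is the list of its \<open>m\<close> columns \<open>(s\<^sub>j, t\<^sub>j)\<close>.  The set contains the matrices for
  all \<open>m \<ge> 1\<close>; it is finite because \<open>m\<close> and all entries are bounded by the sum of \<open>is\<close>.  The
  inequality is the condition \<open>\<Sum> t\<^sub>j \<ge> m + k - 2\<close>, where \<open>k = length is\<close>.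
\<close>

definition gd_matrices :: "nat \<Rightarrow> nat list \<Rightarrow> (nat \<times> nat) list set" where
  "gd_matrices n is = {M. M \<noteq> [] \<and>
     (\<forall>(s, t) \<in> set M. 1 \<le> s \<and> s < n \<and> 1 \<le> t) \<and>
     sum_list is = (\<Sum>(s, t)\<leftarrow>M. s + t) \<and>
     length M + length is \<le> (\<Sum>(s, t)\<leftarrow>M. t) + 2 \<and>
     even (length is + length M + (\<Sum>(s, t)\<leftarrow>M. t))}"

lemma finite_gd_matrices: "finite (gd_matrices n is)"
proof (rule finite_subset)
  define r where "r = sum_list is"
  have *: "length M \<le> (\<Sum>(s, t)\<leftarrow>M. s + t) \<and> set M \<subseteq> {..(\<Sum>(s, t)\<leftarrow>M. s + t)} \<times> {..(\<Sum>(s, t)\<leftarrow>M. s + t)}"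
    if "\<forall>(s, t) \<in> set M. 1 \<le> s \<and> s < n \<and> 1 \<le> t" for M :: "(nat \<times> nat) list"
    using that by (induction M) fastforce+
  show "gd_matrices n is \<subseteq> {M. set M \<subseteq> {..r} \<times> {..r} \<and> length M \<le> r}"
    using * unfolding gd_matrices_def r_def by fastforce
  show "finite {M. set M \<subseteq> {..r} \<times> {..r} \<and> length M \<le> r}"
    by (rule finite_lists_length_le) simp
qed

end

theory Submission
  imports Defs
begin

text \<open>
  Write \<open>w = 1 + \<Sum> \<xi>\<^sub>i k\<^sup>-\<^sup>i\<close> and let \<open>S\<close> be the shift \<open>x\<^sub>i \<mapsto> x\<^sub>i - \<lambda>\<^sup>-\<^sup>i / i\<close>.  If all
  \<open>\<partial>\<^sub>l \<psi>\<close> are differential operators in \<open>\<partial>\<close> applied to \<open>\<psi>\<close>, then so is every coefficient of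
  \<open>S \<psi>\<close>.  As \<open>S \<psi>\<close> is \<open>exp (\<Sum> x\<^sub>j k\<^sup>j) (1 - k / \<lambda>) S w\<close>, its coefficients of \<open>\<lambda>\<^sup>-\<^sup>r\<close> with \<open>r \<ge> 2\<close> have
  no positive powers of \<open>k\<close>, hence the operators have order zero.  Comparing coefficients, the KP
  hierarchy is equivalent to the differential Fay identity
  \<open>exp (- \<Delta>\<^sub>\<lambda> \<Delta>\<^sub>k v) = 1 + \<partial> (\<Delta>\<^sub>\<lambda> - \<Delta>\<^sub>k) v / (\<lambda> - k)\<close>, where \<open>\<Delta>\<^sub>\<lambda> = 1 - S\<close>.

  The half shifts in \<open>\<lambda>\<close> and \<open>k\<close> turn it into an identity that is even in the derivations.  Its
  \<open>(i, j)\<close> coefficient expresses \<open>\<partial>\<^sub>i \<partial>\<^sub>j v - (i j / (i + j - 1)) \<partial> \<partial>\<^sub>i\<^sub>+\<^sub>j\<^sub>-\<^sub>1 v\<close> by derivatives of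
  lower weight or of higher order.  When \<open>\<partial>\<^sub>n \<partial>\<^sub>j v = 0\<close>, the \<open>(n, j)\<close> coefficient eliminates
  \<open>\<partial> \<partial>\<^sub>n\<^sub>+\<^sub>j\<^sub>-\<^sub>1 v\<close>, and a well-founded recursion reduces all derivatives to the \<open>\<partial>\<^sub>s \<partial>\<^sup>t v\<close> with
  \<open>s < n\<close>.  Conversely, each coefficient of the Fay identity holds as soon as the derivatives in it
  are given by the outcome of this recursion.
\<close>

section \<open>Calculus of power series in countably many variables\<close>

lemma mcoeff_add [simp]: "mcoeff (f + g) M = mcoeff f M + mcoeff g M"
  by transfer simp

lemma mcoeff_zero [simp]: "mcoeff 0 M = 0"
  by transfer simp

lemma mcoeff_mult: "mcoeff (f * g) M = (\<Sum>(A, B) \<in> {(A, B). A + B = M}. mcoeff f A * mcoeff g B)"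
  by transfer simp

lemma mcoeff_pd:
  "mcoeff (pd i f) M = of_nat (count M (i - 1) + 1) * mcoeff f (add_mset (i - 1) M)"
  by transfer simp

lemma mcoeff_mconst: "mcoeff (mconst a) M = (if M = {#} then a else 0)"
  by transfer simp

lemma mconst_0 [simp]: "mconst 0 = 0"
  by transfer auto

lemma mconst_1 [simp]: "mconst 1 = 1"
  by transfer auto

lemma mconst_add: "mconst (a + b) = mconst a + mconst (b :: 'a :: comm_ring_1)"
  by transfer auto

lemma mconst_uminus: "mconst (- a) = - mconst (a :: 'a :: comm_ring_1)"
  by transfer auto

lemma mcoeff_mconst_mult:
  fixes f :: "'a :: comm_ring_1 mvps"
  shows "mcoeff (mconst a * f) M = a * mcoeff f M"
proof -
  have "mcoeff (mconst a * f) M = (\<Sum>(A, B) \<in> {({#}, M)}. mcoeff (mconst a) A * mcoeff f B)"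
    unfolding mcoeff_mult
    by (rule sum.mono_neutral_right) (auto intro: finite_mset_splits simp: mcoeff_mconst split: if_splits)
  then show ?thesis by (simp add: mcoeff_mconst)
qed

lemma mconst_mult: "mconst (a * b) = mconst a * mconst (b :: 'a :: comm_ring_1)"
  by (rule mvps_eqI) (simp add: mcoeff_mconst_mult mcoeff_mconst)

lemma mconst_of_nat: "mconst (of_nat k) = (of_nat k :: 'a :: comm_ring_1 mvps)"
  by (induction k) (simp_all add: mconst_add)

text \<open>In a splitting \<open>A + B\<close> of \<open>add_mset x M\<close>, the multiplicity of
  \<open>x\<close> is the sum of its multiplicities in \<open>A\<close> and in \<open>B\<close>; the
  two resulting sums are the two terms of the product rule.\<close>

lemma pd_mult: "pd i (f * g) = pd i f * g + f * pd i (g :: 'a :: comm_ring_1 mvps)"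
proof (rule mvps_eqI)
  fix M
  define x where "x = i - 1"
  let ?S = "{(A, B). A + B = M}" and ?T = "{(A, B). A + B = add_mset x M}"
  have fT: "finite ?T" by (rule finite_mset_splits)
  have left: "(\<Sum>(A, B) \<in> ?T. of_nat (count A x) * (u A * w B))
      = (\<Sum>(A, B) \<in> ?S. of_nat (count A x + 1) * (u (add_mset x A) * w B))"
    for u w :: "nat multiset \<Rightarrow> 'a"
  proof -
    have "(\<Sum>(A, B) \<in> ?T. of_nat (count A x) * (u A * w B))
        = (\<Sum>(A, B) \<in> {(A, B) \<in> ?T. x \<in># A}. of_nat (count A x) * (u A * w B))"
      by (rule sum.mono_neutral_right) (use fT in \<open>auto intro: fT, metis count_eq_zero_iff mult_zero_left of_nat_0\<close>)
    also have "\<dots> = (\<Sum>(A, B) \<in> ?S. of_nat (count A x + 1) * (u (add_mset x A) * w B))"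
      by (rule sum.reindex_bij_witness[where j = "\<lambda>(A, B). (A - {#x#}, B)"
            and i = "\<lambda>(A, B). (add_mset x A, B)"])
         (auto simp: multi_member_split dest!: multi_member_split)
    finally show ?thesis .
  qed
  have swap: "(\<Sum>(A, B) \<in> {(A, B). A + B = K}. F A B) = (\<Sum>(A, B) \<in> {(A, B). A + B = K}. F B A)"
    for F :: "nat multiset \<Rightarrow> nat multiset \<Rightarrow> 'a" and K
    by (rule sum.reindex_bij_witness[where i = prod.swap and j = prod.swap]) (auto simp: ac_simps)
  have right: "(\<Sum>(A, B) \<in> ?T. of_nat (count B x) * (u A * w B))
      = (\<Sum>(A, B) \<in> ?S. u A * (of_nat (count B x + 1) * w (add_mset x B)))"
    for u w :: "nat multiset \<Rightarrow> 'a"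
    using left[of w u] swap[of "\<lambda>A B. of_nat (count B x) * (u A * w B)" "add_mset x M"]
      swap[of "\<lambda>A B. u A * (of_nat (count B x + 1) * w (add_mset x B))" M]
    by (simp add: ac_simps case_prod_beta)
  have "mcoeff (pd i (f * g)) M
      = (\<Sum>(A, B) \<in> ?T. of_nat (count M x + 1) * (mcoeff f A * mcoeff g B))"
    by (simp add: mcoeff_pd mcoeff_mult x_def sum_distrib_left case_prod_beta)
  also have "\<dots> = (\<Sum>(A, B) \<in> ?T. of_nat (count A x) * (mcoeff f A * mcoeff g B)
      + of_nat (count B x) * (mcoeff f A * mcoeff g B))"
  proof (rule sum.cong[OF refl], clarify)
    fix A B assume "A + B = add_mset x M"
    then have "count M x + 1 = count A x + count B x"
      by (metis Suc_eq_plus1 count_add_mset count_union)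
    then show "of_nat (count M x + 1) * (mcoeff f A * mcoeff g B)
        = of_nat (count A x) * (mcoeff f A * mcoeff g B)
          + of_nat (count B x) * (mcoeff f A * mcoeff g B)"
      by (simp add: distrib_right)
  qed
  also have "\<dots> = mcoeff (pd i f * g + f * pd i g) M"
    unfolding mcoeff_add mcoeff_mult[of "pd i f"] mcoeff_mult[of f] mcoeff_pd x_def[symmetric]
    using left[of "mcoeff f" "mcoeff g"] right[of "mcoeff f" "mcoeff g"]
    by (simp add: sum.distrib case_prod_beta mult.assoc)
  finally show "mcoeff (pd i (f * g)) M = mcoeff (pd i f * g + f * pd i g) M" .
qed

lemma pd_mconst [simp]: "pd i (mconst a) = 0"
  by (rule mvps_eqI) (simp add: mcoeff_pd mcoeff_mconst)

lemma pd_1 [simp]: "pd i 1 = 0"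
  using pd_mconst[of i 1] by simp

lemma pd_mconst_mult: "pd i (mconst a * f) = mconst a * pd i f"
  by (simp add: pd_mult)

lemma pd_uminus: "pd i (- f) = - pd i f"
  using pd_add[of i f "- f"] by (simp add: minus_unique)

lemma pd_diff: "pd i (f - g) = pd i f - pd i g"
  using pd_add[of i f "- g"] by (simp add: pd_uminus)

lemma pd_sum: "pd i (\<Sum>x\<in>A. f x) = (\<Sum>x\<in>A. pd i (f x))"
  by (induction A rule: infinite_finite_induct) (simp_all add: pd_add)

lemma pds_Nil [simp]: "pds [] f = f"
  by (simp add: pds_def)

lemma pds_Cons [simp]: "pds (i # is) f = pd i (pds is f)"
  by (simp add: pds_def)

lemma of_nat_Suc_mult_eq_0:
  fixes f :: "complex mvps"
  assumes "of_nat (Suc k) * f = 0"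
  shows "f = 0"
proof -
  have "mconst (1 / of_nat (Suc k)) * (mconst (of_nat (Suc k)) * f) = f"
    by (simp del: of_nat_Suc add: mult.assoc[symmetric] mconst_mult[symmetric])
  with assms show ?thesis by (simp del: of_nat_Suc add: mconst_of_nat)
qed

lemma of_nat_mult_cancel:
  fixes f g :: "complex mvps"
  assumes "of_nat r * f = of_nat r * g" "r \<noteq> 0"
  shows "f = g"
  using of_nat_Suc_mult_eq_0[of "r - 1" "f - g"] assms by (simp add: right_diff_distrib)

section \<open>Exponentials and Hasse--Schmidt derivations\<close>

text \<open>The recursion makes \<open>c l\<close> an inverse of the factorial of \<open>l\<close>,
  which gives an exponential series over a ring that need not be a field.\<close>

locale exp_coeffs =
  fixes c :: "nat \<Rightarrow> 'a :: comm_ring_1"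
  assumes c_0: "c 0 = 1"
    and c_Suc: "of_nat (Suc l) * c (Suc l) = c l"
begin

definition fexp :: "'a fps \<Rightarrow> 'a fps" where
  "fexp b = Abs_fps c oo b"

lemma fact_mult_c: "of_nat (fact l) * c l = 1"
proof (induction l)
  case (Suc l)
  have "of_nat (fact (Suc l)) * c (Suc l) = of_nat (fact l) * (of_nat (Suc l) * c (Suc l))"
    by (simp only: fact_Suc of_nat_mult mult.assoc mult.left_commute of_nat_fact of_nat_id)
  with Suc show ?case by (simp only: c_Suc)
qed (simp add: c_0)

lemma of_nat_Suc_cancel:
  assumes "of_nat (Suc l) * x = (0 :: 'a)"
  shows "x = 0"
proof -
  have "x = of_nat (fact (Suc l)) * c (Suc l) * x"
    by (simp only: fact_mult_c mult_1)
  also have "\<dots> = of_nat (fact l) * c (Suc l) * (of_nat (Suc l) * x)"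
    by (simp only: fact_Suc of_nat_mult ac_simps of_nat_fact of_nat_id)
  finally show ?thesis using assms by simp
qed

text \<open>Powers of \<open>b\<close> beyond the \<open>k\<close>-th start above degree
  \<open>k\<close>, so truncating anywhere from \<open>k\<close> on leaves this coefficient
  unchanged.\<close>

lemma fexp_nth:
  assumes "b $ 0 = 0" "k \<le> N"
  shows "fexp b $ k = (\<Sum>i=0..N. fps_const (c i) * b ^ i) $ k"
proof -
  have "(\<Sum>i=0..N. c i * (b ^ i) $ k) = (\<Sum>i=0..k. c i * (b ^ i) $ k)"
    using assms by (intro sum.mono_neutral_right) (auto simp: startsby_zero_power_prefix)
  then show ?thesis
    by (simp add: fexp_def fps_compose_nth fps_sum_nth)
qed

lemma fexp_nth_0 [simp]: "fexp b $ 0 = 1"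
  by (simp add: fexp_def c_0)

lemma fexp_0 [simp]: "fexp 0 = 1"
  by (simp add: fexp_def c_0)

text \<open>The truncations satisfy the equation with a lag of one: the derivative of
  \<open>?P (Suc N)\<close> is \<open>?P N * fps_deriv b\<close>.\<close>

lemma fps_deriv_fexp:
  assumes "b $ 0 = 0"
  shows "fps_deriv (fexp b) = fexp b * fps_deriv b"
proof (rule fps_ext)
  fix k
  let ?P = "\<lambda>N. \<Sum>i=0..N. fps_const (c i) * b ^ i"
  have dP: "fps_deriv (?P (Suc N)) = ?P N * fps_deriv b" for N
  proof (induction N)
    case 0
    show ?case using c_Suc[of 0] by (simp add: c_0)
  next
    case (Suc N)
    have "fps_const (c (Suc (Suc N))) * fps_const (of_nat (Suc (Suc N))) = fps_const (c (Suc N))"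
      using c_Suc[of "Suc N"] by (simp only: fps_const_mult mult.commute)
    then have "fps_deriv (fps_const (c (Suc (Suc N))) * b ^ Suc (Suc N))
        = fps_const (c (Suc N)) * b ^ Suc N * fps_deriv b"
      by (simp only: fps_deriv_mult fps_deriv_power fps_deriv_const mult_zero_left add_0_right
          mult.assoc[symmetric]) (simp add: mult.assoc mult.left_commute mult.commute)
    with Suc show ?case by (simp add: distrib_right)
  qed
  have "fps_deriv (fexp b) $ k = fps_deriv (?P (Suc k)) $ k"
    unfolding fps_deriv_nth using fexp_nth[OF assms, of "Suc k" "Suc k"]
    by (simp only: Suc_eq_plus1 order_refl simp_thms)
  also have "\<dots> = (?P k * fps_deriv b) $ k" by (simp only: dP)
  also have "\<dots> = (fexp b * fps_deriv b) $ k"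
    unfolding fps_mult_nth by (rule sum.cong) (auto simp: fexp_nth[OF assms, of _ k])
  finally show "fps_deriv (fexp b) $ k = (fexp b * fps_deriv b) $ k" .
qed

text \<open>Coefficient \<open>l + 1\<close> of \<open>F\<close>, multiplied by
  \<open>l + 1\<close>, is a combination of earlier ones. This uniqueness yields the addition
  theorem for \<open>fexp\<close>.\<close>

lemma linear_ode_zero:
  fixes F K :: "'a fps"
  assumes "fps_deriv F = F * K" "F $ 0 = 0"
  shows "F = 0"
proof -
  have "F $ k = 0" for k
  proof (induction k rule: less_induct)
    case (less k)
    show ?case
    proof (cases k)
      case (Suc l)
      have "of_nat (Suc l) * F $ Suc l = (F * K) $ l"
        using assms(1) by (metis Suc_eq_plus1 fps_deriv_nth)
      also have "\<dots> = 0"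
        unfolding fps_mult_nth using less Suc by (intro sum.neutral) auto
      finally show ?thesis using of_nat_Suc_cancel Suc by metis
    qed (simp add: assms(2))
  qed
  then show ?thesis by (intro fps_ext) simp
qed

lemma fexp_add:
  assumes "a $ 0 = 0" "b $ 0 = 0"
  shows "fexp (a + b) = fexp a * fexp b"
proof -
  have "fexp (a + b) - fexp a * fexp b = 0"
    using assms
    by (intro linear_ode_zero[where K = "fps_deriv (a + b)"])
       (simp_all add: fps_deriv_fexp algebra_simps)
  then show ?thesis by simp
qed

lemma fexp_inverse: "b $ 0 = 0 \<Longrightarrow> fexp b * fexp (- b) = 1"
  using fexp_add[of b "- b"] by simp

lemma fexp_mult_cancel:
  assumes "b $ 0 = 0" "fexp b * f = fexp b * g"
  shows "f = g"
  using assms fexp_inverse[of b] by (metis mult.assoc mult.commute mult_1)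

end

text \<open>The truncation hypothesis says that \<open>T\<close> is continuous for the adic topologies.\<close>

lemma fexp_hom:
  fixes T :: "'a :: comm_ring_1 fps \<Rightarrow> 'b :: comm_ring_1 fps"
  assumes c: "exp_coeffs c" and d: "exp_coeffs d"
    and T_add: "\<And>F G. T (F + G) = T F + T G"
    and T_mult: "\<And>F G. T (F * G) = T F * T G"
    and T_1: "T 1 = 1"
    and T_const: "\<And>l. T (fps_const (c l)) = fps_const (d l)"
    and T_trunc: "\<And>F k. (\<And>i. i \<le> k \<Longrightarrow> F $ i = 0) \<Longrightarrow> T F $ k = 0"
    and b: "b $ 0 = 0"
  shows "T (exp_coeffs.fexp c b) = exp_coeffs.fexp d (T b)"
proof (rule fps_ext)
  fix k
  have T_0: "T 0 = 0" using T_add[of 0 0] by simp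
  have T_uminus: "T (- F) = - T F" for F
    using T_add[of F "- F"] T_0 by (simp add: minus_unique)
  have T_power: "T (F ^ i) = T F ^ i" for F i
    by (induction i) (simp_all add: T_1 T_mult)
  have T_sum: "T (\<Sum>i\<in>A. F i) = (\<Sum>i\<in>A. T (F i))" for F and A :: "nat set"
    by (induction A rule: infinite_finite_induct) (simp_all add: T_0 T_add)
  have Tb: "T b $ 0 = 0" using T_trunc[of 0 b] b by simp
  let ?P = "\<Sum>i=0..k. fps_const (c i) * b ^ i"
  have "T (exp_coeffs.fexp c b + - ?P) $ k = 0"
    by (rule T_trunc) (simp add: exp_coeffs.fexp_nth[OF c b, of _ k])
  then have "T (exp_coeffs.fexp c b) $ k = T ?P $ k"
    by (simp only: T_add T_uminus) simp
  also have "T ?P = (\<Sum>i=0..k. fps_const (d i) * T b ^ i)"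
    by (simp add: T_sum T_mult T_power T_const)
  also have "\<dots> $ k = exp_coeffs.fexp d (T b) $ k"
    by (rule exp_coeffs.fexp_nth[OF d Tb order_refl, symmetric])
  finally show "T (exp_coeffs.fexp c b) $ k = exp_coeffs.fexp d (T b) $ k" .
qed

definition fps_map :: "('a \<Rightarrow> 'b) \<Rightarrow> 'a fps \<Rightarrow> 'b fps" where
  "fps_map f F = Abs_fps (\<lambda>k. f (F $ k))"

lemma fps_map_nth [simp]: "fps_map f F $ k = f (F $ k)"
  by (simp add: fps_map_def)

text \<open>
  A Hasse--Schmidt derivation is a sequence of additive maps for which
  \<open>f \<mapsto> \<Sum>m. \<sigma> m f y\<^sup>m\<close> is a ring homomorphism into the power series in \<open>y\<close>.
\<close>

locale hasse_schmidt =
  fixes \<sigma> :: "nat \<Rightarrow> 'a :: comm_ring_1 \<Rightarrow> 'a"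
  assumes id: "\<sigma> 0 f = f"
    and add: "\<sigma> m (f + g) = \<sigma> m f + \<sigma> m g"
    and mult: "\<sigma> m (f * g) = (\<Sum>i=0..m. \<sigma> i f * \<sigma> (m - i) g)"
begin

lemma zero [simp]: "\<sigma> m 0 = 0"
  using add[of m 0 0] by simp

lemma sum: "\<sigma> m (\<Sum>x\<in>A. f x) = (\<Sum>x\<in>A. \<sigma> m (f x))"
  by (induction A rule: infinite_finite_induct) (simp_all add: add)

text \<open>The homomorphism into power series in \<open>y\<close> given by \<open>\<sigma>\<close>,
  extended to power series in the same \<open>y\<close>, which it fixes.\<close>

definition total :: "'a fps \<Rightarrow> 'a fps" where
  "total F = Abs_fps (\<lambda>k. \<Sum>i=0..k. \<sigma> (k - i) (F $ i))"

lemma total_nth: "total F $ k = (\<Sum>i=0..k. \<sigma> (k - i) (F $ i))"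
  by (simp add: total_def)

lemma total_add: "total (F + G) = total F + total G"
  by (rule fps_ext) (simp add: total_nth add sum.distrib)

lemma total_mult: "total (F * G) = total F * total G"
proof (rule fps_ext)
  fix k
  have "total (F * G) $ k
      = (\<Sum>i=0..k. \<Sum>a=0..i. \<Sum>p=0..k-i. \<sigma> p (F $ a) * \<sigma> (k - i - p) (G $ (i - a)))"
    by (simp add: total_nth fps_mult_nth sum mult)
  also have "\<dots> = (\<Sum>(i, a, p) \<in> (SIGMA i:{0..k}. {0..i} \<times> {0..k-i}).
      \<sigma> p (F $ a) * \<sigma> (k - i - p) (G $ (i - a)))"
    by (simp add: sum.Sigma sum.cartesian_product)
  also have "\<dots> = (\<Sum>(i, a, b) \<in> (SIGMA i:{0..k}. {0..i} \<times> {0..k-i}).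
      \<sigma> (i - a) (F $ a) * \<sigma> (k - i - b) (G $ b))"
    by (rule sum.reindex_bij_witness[where i = "\<lambda>(i, a, b). (a + b, a, i - a)"
          and j = "\<lambda>(i, a, p). (a + p, a, i - a)"])
       (auto simp: add.commute)
  also have "\<dots> = (\<Sum>i=0..k. \<Sum>a=0..i. \<Sum>b=0..k-i. \<sigma> (i - a) (F $ a) * \<sigma> (k - i - b) (G $ b))"
    by (simp add: sum.Sigma sum.cartesian_product)
  also have "\<dots> = (total F * total G) $ k"
    by (simp add: total_nth fps_mult_nth sum_product)
  finally show "total (F * G) $ k = (total F * total G) $ k" .
qed

text \<open>Makes \<open>total\<close> available for a second, outer variable over series in the
  inner one.\<close>

lemma hasse_schmidt_fps_map: "hasse_schmidt (\<lambda>m. fps_map (\<sigma> m))"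
proof
  fix m f g
  show "fps_map (\<sigma> 0) f = f" by (rule fps_ext) (simp add: id)
  show "fps_map (\<sigma> m) (f + g) = fps_map (\<sigma> m) f + fps_map (\<sigma> m) g"
    by (rule fps_ext) (simp add: add)
  show "fps_map (\<sigma> m) (f * g) = (\<Sum>i=0..m. fps_map (\<sigma> i) f * fps_map (\<sigma> (m - i)) g)"
  proof (rule fps_ext)
    fix k
    show "fps_map (\<sigma> m) (f * g) $ k
        = (\<Sum>i=0..m. fps_map (\<sigma> i) f * fps_map (\<sigma> (m - i)) g) $ k"
      by (simp add: fps_mult_nth fps_sum_nth sum mult) (rule sum.swap)
  qed
qed

end

section \<open>Shifts of the variables\<close>

text \<open>Both sides run over the triples with sum \<open>r\<close> whose first entry
  \<open>p\<close> is positive. Such sums arise when the Euler recursion is applied to one factor of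
  a convolution.\<close>

lemma sum_triangle_left:
  fixes g :: "nat \<Rightarrow> nat \<Rightarrow> nat \<Rightarrow> 'a :: comm_monoid_add"
  shows "(\<Sum>i=0..r. \<Sum>p=1..i. g p (i - p) (r - i)) = (\<Sum>p=1..r. \<Sum>i=0..r-p. g p i (r - p - i))"
proof -
  have "(\<Sum>i=0..r. \<Sum>p=1..i. g p (i - p) (r - i))
      = (\<Sum>(i, p) \<in> (SIGMA i:{0..r}. {1..i}). g p (i - p) (r - i))"
    by (simp add: sum.Sigma)
  also have "\<dots> = (\<Sum>(p, i) \<in> (SIGMA p:{1..r}. {0..r-p}). g p i (r - p - i))"
    by (rule sum.reindex_bij_witness[where i = "\<lambda>(p, i). (i + p, p)" and j = "\<lambda>(i, p). (p, i - p)"])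
       auto
  finally show ?thesis by (simp add: sum.Sigma)
qed

lemma sum_triangle_right:
  fixes g :: "nat \<Rightarrow> nat \<Rightarrow> nat \<Rightarrow> 'a :: comm_monoid_add"
  shows "(\<Sum>i=0..r. \<Sum>p=1..r-i. g p i (r - i - p)) = (\<Sum>p=1..r. \<Sum>i=0..r-p. g p i (r - p - i))"
proof -
  have "(\<Sum>i=0..r. \<Sum>p=1..r-i. g p i (r - i - p))
      = (\<Sum>(i, p) \<in> (SIGMA i:{0..r}. {1..r-i}). g p i (r - i - p))"
    by (simp add: sum.Sigma)
  also have "\<dots> = (\<Sum>(p, i) \<in> (SIGMA p:{1..r}. {0..r-p}). g p i (r - p - i))"
    by (rule sum.reindex_bij_witness[where i = "\<lambda>(p, i). (i, p)" and j = "\<lambda>(i, p). (p, i)"])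
       (auto simp: add.commute)
  finally show ?thesis by (simp add: sum.Sigma)
qed

text \<open>\<open>cpow l r\<close> is the coefficient of \<open>y\<^sup>r\<close> in \<open>(\<Sum>i. y\<^sup>i \<partial>\<^sub>i / i)\<^sup>l\<close>.\<close>

primrec cpow :: "nat \<Rightarrow> nat \<Rightarrow> complex mvps \<Rightarrow> complex mvps" where
  "cpow 0 r f = (if r = 0 then f else 0)"
| "cpow (Suc l) r f = (\<Sum>i=1..r. mconst (1 / of_nat i) * pd i (cpow l (r - i) f))"

lemma cpow_eq_0: "r < l \<Longrightarrow> cpow l r f = 0"
  by (induction l arbitrary: r) (auto intro!: sum.neutral)

lemma cpow_zero [simp]: "cpow l r 0 = 0"
  by (induction l arbitrary: r) auto

lemma cpow_add: "cpow l r (f + g) = cpow l r f + cpow l r g"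
  by (induction l arbitrary: r) (simp_all add: pd_add distrib_left sum.distrib)

lemma cpow_mconst_mult: "cpow l r (mconst a * f) = mconst a * cpow l r f"
  by (induction l arbitrary: r)
     (simp_all add: pd_mconst_mult sum_distrib_left mult.left_commute)

lemma pd_cpow: "pd i (cpow l r f) = cpow l r (pd i f)"
proof (induction l arbitrary: r)
  case (Suc l)
  show ?case by (simp add: pd_sum pd_mconst_mult pd_commute[of i] Suc)
qed simp

lemma finite_bounded_lists: "finite {is. length is = l \<and> (\<forall>i\<in>set is. i \<ge> 1) \<and> sum_list is = (r :: nat)}"
proof (rule finite_subset)
  show "{is. length is = l \<and> (\<forall>i\<in>set is. i \<ge> 1) \<and> sum_list is = r}
      \<subseteq> {is. set is \<subseteq> {..r} \<and> length is \<le> l}"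
    using member_le_sum_list by fastforce
qed (simp add: finite_lists_length_le)

lemma cpow_pds:
  "cpow l r f = (\<Sum>is | length is = l \<and> (\<forall>i\<in>set is. i \<ge> 1) \<and> sum_list is = r.
     mconst (1 / of_nat (prod_list is)) * pds is f)"
proof (induction l arbitrary: r)
  case 0
  have "{is :: nat list. length is = 0 \<and> (\<forall>i\<in>set is. i \<ge> 1) \<and> sum_list is = r}
      = (if r = 0 then {[]} else {})" by auto
  then show ?case by simp
next
  case (Suc l)
  let ?A = "\<lambda>l r. {is. length is = l \<and> (\<forall>i\<in>set is. i \<ge> 1) \<and> sum_list is = (r :: nat)}"
  have "cpow (Suc l) r f
      = (\<Sum>(i, is) \<in> (SIGMA i:{1..r}. ?A l (r - i)).
           mconst (1 / of_nat i) * (mconst (1 / of_nat (prod_list is)) * pd i (pds is f)))"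
    by (simp add: Suc pd_sum pd_mconst_mult sum_distrib_left sum.Sigma finite_bounded_lists[simplified])
  also have "\<dots> = (\<Sum>is\<in>?A (Suc l) r. mconst (1 / of_nat (prod_list is)) * pds is f)"
    by (rule sum.reindex_bij_witness[where i = "\<lambda>is. (hd is, tl is)" and j = "\<lambda>(i, is). i # is"])
       (auto simp: length_Suc_conv mult.assoc[symmetric] mconst_mult[symmetric])
  finally show ?case .
qed

text \<open>With \<open>A = \<Sum>i. y^i \<partial>_i / i\<close> this is
  \<open>y d/dy A^(l+1) = (l+1) A^l (y A')\<close>; in \<open>y A'\<close> the denominators
  cancel.\<close>

lemma cpow_euler:
  "of_nat r * cpow (Suc l) r f = of_nat (Suc l) * (\<Sum>i=1..r. pd i (cpow l (r - i) f))"
proof (induction l arbitrary: r)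
  case 0
  have "(\<Sum>i=1..r. pd i (cpow 0 (r - i) f)) = (\<Sum>i\<in>(if r = 0 then {} else {r}). pd i (cpow 0 (r - i) f))"
    by (rule sum.mono_neutral_right) auto
  moreover have "cpow 1 r f = (\<Sum>i\<in>(if r = 0 then {} else {r}). mconst (1 / of_nat i) * pd i (cpow 0 (r - i) f))"
    unfolding One_nat_def cpow.simps(2) by (rule sum.mono_neutral_right) auto
  ultimately show ?case
    by (cases "r = 0")
       (simp_all add: mult.assoc[symmetric] mconst_mult[symmetric] mconst_of_nat[symmetric] del: cpow.simps(2))
next
  case (Suc l)
  \<comment> \<open>Write \<open>r = i + (r - i)\<close>: the first part differentiates the
    outermost factor \<open>A\<close>, the second one, by induction, the remaining power.\<close>
  have split: "of_nat r * (mconst (1 / of_nat i) * pd i (cpow (Suc l) (r - i) f))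
      = pd i (cpow (Suc l) (r - i) f)
        + of_nat (Suc l) * (\<Sum>j=1..r-i. mconst (1 / of_nat i) * pd i (pd j (cpow l (r - i - j) f)))"
    if "i \<in> {1..r}" for i
  proof -
    have r: "(of_nat r :: complex mvps) = mconst (of_nat i) + of_nat (r - i)"
      using that by (simp add: mconst_of_nat flip: of_nat_add)
    have "mconst (of_nat i) * (mconst (1 / of_nat i) * pd i (cpow (Suc l) (r - i) f))
        = pd i (cpow (Suc l) (r - i) f)"
      using that by (simp add: mult.assoc[symmetric] mconst_mult[symmetric] del: cpow.simps)
    moreover have "of_nat (r - i) * (mconst (1 / of_nat i) * pd i (cpow (Suc l) (r - i) f))
        = mconst (1 / of_nat i) * pd i (of_nat (r - i) * cpow (Suc l) (r - i) f)"
      by (simp only: mconst_of_nat[symmetric] pd_mconst_mult mult.left_commute)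
    moreover have "\<dots> = of_nat (Suc l) *
        (\<Sum>j=1..r-i. mconst (1 / of_nat i) * pd i (pd j (cpow l (r - i - j) f)))"
      unfolding Suc
      by (simp only: mconst_of_nat[symmetric] pd_mconst_mult pd_sum sum_distrib_left mult.left_commute)
    ultimately show ?thesis unfolding r distrib_right by simp
  qed
  have "(\<Sum>i=1..r. \<Sum>j=1..r-i. mconst (1 / of_nat i) * pd i (pd j (cpow l (r - i - j) f)))
      = (\<Sum>j=1..r. pd j (cpow (Suc l) (r - j) f))"
  proof -
    have "(\<Sum>i=1..r. \<Sum>j=1..r-i. mconst (1 / of_nat i) * pd i (pd j (cpow l (r - i - j) f)))
        = (\<Sum>(i, j) \<in> (SIGMA i:{1..r}. {1..r-i}).
             mconst (1 / of_nat i) * pd i (pd j (cpow l (r - i - j) f)))"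
      by (simp add: sum.Sigma)
    also have "\<dots> = (\<Sum>(j, i) \<in> (SIGMA j:{1..r}. {1..r-j}).
             mconst (1 / of_nat i) * pd j (pd i (cpow l (r - j - i) f)))"
      by (rule sum.reindex_bij_witness[where i = prod.swap and j = prod.swap])
         (auto simp: pd_commute add.commute)
    finally show ?thesis by (simp add: sum.Sigma pd_sum pd_mconst_mult)
  qed
  moreover have "of_nat r * cpow (Suc (Suc l)) r f = (\<Sum>i=1..r. pd i (cpow (Suc l) (r - i) f)
        + of_nat (Suc l) * (\<Sum>j=1..r-i. mconst (1 / of_nat i) * pd i (pd j (cpow l (r - i - j) f))))"
    unfolding cpow.simps(2)[of "Suc l"] sum_distrib_left[of "of_nat r"] by (rule sum.cong[OF refl split])
  ultimately have "of_nat r * cpow (Suc (Suc l)) r f = (\<Sum>i=1..r. pd i (cpow (Suc l) (r - i) f))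
      + of_nat (Suc l) * (\<Sum>i=1..r. pd i (cpow (Suc l) (r - i) f))"
    by (simp only: sum.distrib sum_distrib_left[symmetric])
  then show ?case by (simp only: of_nat_Suc[of "Suc l"] distrib_right mult_1)
qed

text \<open>\<open>shift a r\<close> is the coefficient of \<open>y\<^sup>r\<close> in \<open>exp (a \<Sum>i. y\<^sup>i \<partial>\<^sub>i / i)\<close>.\<close>

definition shift :: "complex \<Rightarrow> nat \<Rightarrow> complex mvps \<Rightarrow> complex mvps" where
  "shift a r f = (\<Sum>l=0..r. mconst (a ^ l / fact l) * cpow l r f)"

lemma shift_0 [simp]: "shift a 0 f = f"
  by (simp add: shift_def)

lemma shift_zero [simp]: "shift a r 0 = 0"
  by (simp add: shift_def)

lemma shift_add: "shift a r (f + g) = shift a r f + shift a r g"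
  by (simp add: shift_def cpow_add distrib_left sum.distrib)

lemma shift_mconst_mult: "shift a r (mconst b * f) = mconst b * shift a r f"
  by (simp add: shift_def cpow_mconst_mult sum_distrib_left mult.left_commute)

lemma pd_shift: "pd i (shift a r f) = shift a r (pd i f)"
  by (simp add: shift_def pd_sum pd_mconst_mult pd_cpow)

lemma shift_uminus: "shift a r (- f) = - shift a r f"
  using shift_add[of a r f "- f"] by (simp add: minus_unique)

lemma shift_diff: "shift a r (f - g) = shift a r f - shift a r g"
  using shift_add[of a r f "- g"] by (simp add: shift_uminus)

lemma shift_sum: "shift a r (\<Sum>x\<in>A. f x) = (\<Sum>x\<in>A. shift a r (f x))"
  by (induction A rule: infinite_finite_induct) (simp_all add: shift_add)

text \<open>The equation \<open>y d/dy exp (a A) = a (y A') exp (a A)\<close>. It determines all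
  coefficients from the one at \<open>r = 0\<close>, so the laws of the shifts follow by comparing
  recursions.\<close>

lemma shift_rec: "of_nat r * shift a r f = mconst a * (\<Sum>i=1..r. pd i (shift a (r - i) f))"
proof (cases r)
  case (Suc q)
  have "of_nat r * shift a r f = (\<Sum>l=0..q. mconst (a ^ Suc l / fact (Suc l)) * (of_nat r * cpow (Suc l) r f))"
    unfolding shift_def Suc sum.atLeast0_atMost_Suc_shift
    by (simp add: sum_distrib_left distrib_left mult.left_commute del: cpow.simps(2) fact_Suc of_nat_Suc)
  also have "\<dots> = (\<Sum>l=0..q. mconst a * (mconst (a ^ l / fact l) * (\<Sum>i=1..r. pd i (cpow l (r - i) f))))"
  proof (rule sum.cong[OF refl])
    fix l
    have "mconst (a ^ Suc l / fact (Suc l)) * (of_nat (Suc l) :: complex mvps) = mconst a * mconst (a ^ l / fact l)"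
      unfolding mconst_of_nat[symmetric] mconst_mult[symmetric]
      by (simp add: field_simps del: of_nat_Suc)
    then show "mconst (a ^ Suc l / fact (Suc l)) * (of_nat r * cpow (Suc l) r f)
        = mconst a * (mconst (a ^ l / fact l) * (\<Sum>i=1..r. pd i (cpow l (r - i) f)))"
      unfolding cpow_euler by (simp only: mult.assoc[symmetric])
  qed
  also have "\<dots> = mconst a * (\<Sum>i=1..r. \<Sum>l=0..q. mconst (a ^ l / fact l) * pd i (cpow l (r - i) f))"
    by (simp only: sum_distrib_left) (rule sum.swap)
  also have "\<dots> = mconst a * (\<Sum>i=1..r. pd i (shift a (r - i) f))"
  proof (intro arg_cong2[of _ _ _ _ "(*)"] refl sum.cong)
    fix i assume i: "i \<in> {1..r}"
    have "(\<Sum>l=0..q. mconst (a ^ l / fact l) * pd i (cpow l (r - i) f))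
        = (\<Sum>l=0..r-i. mconst (a ^ l / fact l) * pd i (cpow l (r - i) f))"
      using i Suc by (intro sum.mono_neutral_right) (auto simp: cpow_eq_0)
    then show "(\<Sum>l=0..q. mconst (a ^ l / fact l) * pd i (cpow l (r - i) f)) = pd i (shift a (r - i) f)"
      by (simp add: shift_def pd_sum pd_mconst_mult)
  qed
  finally show ?thesis .
qed simp

lemma shift_unique:
  assumes "u 0 = f" and "\<And>r. of_nat r * u r = mconst a * (\<Sum>i=1..r. pd i (u (r - i)))"
  shows "u r = shift a r f"
proof (induction r rule: less_induct)
  case (less r)
  show ?case
  proof (cases "r = 0")
    case False
    have "(\<Sum>i=1..r. pd i (u (r - i))) = (\<Sum>i=1..r. pd i (shift a (r - i) f))"
      using less by (intro sum.cong) auto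
    then have "of_nat r * u r = of_nat r * shift a r f"
      by (simp only: assms(2) shift_rec)
    with False show ?thesis using of_nat_mult_cancel by blast
  qed (simp add: assms(1))
qed

text \<open>The exponential of a derivation is multiplicative: by the product rule the convolution
  satisfies the same recursion.\<close>

lemma shift_mult: "shift a r (f * g) = (\<Sum>i=0..r. shift a i f * shift a (r - i) g)"
proof (rule shift_unique[symmetric])
  fix r
  have "of_nat r * (\<Sum>i=0..r. shift a i f * shift a (r - i) g)
      = (\<Sum>i=0..r. (of_nat i * shift a i f) * shift a (r - i) g
          + shift a i f * (of_nat (r - i) * shift a (r - i) g))"
    unfolding sum_distrib_left
    by (rule sum.cong) (auto simp: algebra_simps simp flip: distrib_right of_nat_add)
  also have "\<dots> = mconst a * ((\<Sum>i=0..r. \<Sum>p=1..i. pd p (shift a (i - p) f) * shift a (r - i) g)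
       + (\<Sum>i=0..r. \<Sum>p=1..r-i. shift a i f * pd p (shift a (r - i - p) g)))"
    unfolding shift_rec sum.distrib by (simp add: sum_distrib_left sum_distrib_right algebra_simps)
  also have "\<dots> = mconst a * (\<Sum>p=1..r. pd p (\<Sum>i=0..r-p. shift a i f * shift a (r - p - i) g))"
    unfolding sum_triangle_left[of "\<lambda>p i j. pd p (shift a i f) * shift a j g"]
      sum_triangle_right[of "\<lambda>p i j. shift a i f * pd p (shift a j g)"]
    by (simp add: pd_sum pd_mult sum.distrib)
  finally show "of_nat r * (\<Sum>i=0..r. shift a i f * shift a (r - i) g)
      = mconst a * (\<Sum>p=1..r. pd p (\<Sum>i=0..r-p. shift a i f * shift a (r - p - i) g))" .
qed simp

text \<open>The one-parameter group law: the two shifts contribute \<open>b\<close> and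
  \<open>a\<close> to the scalar of the recursion.\<close>

lemma shift_shift: "(\<Sum>i=0..r. shift a (r - i) (shift b i f)) = shift (a + b) r f"
proof (rule shift_unique)
  fix r
  have "of_nat r * (\<Sum>i=0..r. shift a (r - i) (shift b i f))
      = (\<Sum>i=0..r. shift a (r - i) (of_nat i * shift b i f) + of_nat (r - i) * shift a (r - i) (shift b i f))"
    unfolding sum_distrib_left
    by (rule sum.cong)
       (auto simp: shift_mconst_mult mconst_of_nat[symmetric] mconst_add[symmetric] distrib_right[symmetric]
         simp flip: of_nat_add)
  also have "\<dots> = mconst b * (\<Sum>i=0..r. \<Sum>p=1..i. pd p (shift a (r - i) (shift b (i - p) f)))
      + mconst a * (\<Sum>i=0..r. \<Sum>p=1..r-i. pd p (shift a (r - i - p) (shift b i f)))"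
    unfolding shift_rec sum.distrib shift_mconst_mult shift_sum
    by (simp add: sum_distrib_left pd_shift)
  also have "\<dots> = mconst (a + b) * (\<Sum>p=1..r. pd p (\<Sum>i=0..r-p. shift a (r - p - i) (shift b i f)))"
    unfolding sum_triangle_left[of "\<lambda>p i j. pd p (shift a j (shift b i f))"]
      sum_triangle_right[of "\<lambda>p i j. pd p (shift a j (shift b i f))"]
    by (simp add: pd_sum mconst_add distrib_right add.commute)
  finally show "of_nat r * (\<Sum>i=0..r. shift a (r - i) (shift b i f))
      = mconst (a + b) * (\<Sum>p=1..r. pd p (\<Sum>i=0..r-p. shift a (r - p - i) (shift b i f)))" .
qed simp

lemma shift_commute: "shift a r (shift b q f) = shift b q (shift a r f)"
proof (rule shift_unique[symmetric])
  fix r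
  have "of_nat r * shift b q (shift a r f) = shift b q (of_nat r * shift a r f)"
    by (simp only: mconst_of_nat[symmetric] shift_mconst_mult)
  also have "\<dots> = mconst a * (\<Sum>i=1..r. pd i (shift b q (shift a (r - i) f)))"
    by (simp only: shift_rec shift_mconst_mult shift_sum pd_shift)
  finally show "of_nat r * shift b q (shift a r f)
      = mconst a * (\<Sum>i=1..r. pd i (shift b q (shift a (r - i) f)))" .
qed simp

lemma shift_scalar_0: "r > 0 \<Longrightarrow> shift 0 r f = 0"
  by (simp add: shift_def) (intro sum.neutral, auto simp: power_0_left)

lemma shift_mconst:
  assumes "r > 0"
  shows "shift a r (mconst b) = 0"
proof -
  have "(\<Sum>i=1..r. pd i (if r - i = 0 then mconst b else 0)) = 0" for r
    by (rule sum.neutral) simp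
  then have "(if r = 0 then mconst b else 0) = shift a r (mconst b)"
    by (intro shift_unique[where u = "\<lambda>r. if r = 0 then mconst b else 0"]) simp_all
  with assms show ?thesis by simp
qed

interpretation shift: hasse_schmidt "shift a" for a
  by standard (simp_all add: shift_add shift_mult)

text \<open>Taylor's formula: the compositions of length \<open>l\<close> add up to
  \<open>cpow l\<close>.\<close>

lemma eta_shift: "r > 0 \<Longrightarrow> eta v r = - shift (-1) r v"
proof -
  assume r: "r > 0"
  let ?A = "\<lambda>l. {is. length is = l \<and> (\<forall>i\<in>set is. i \<ge> 1) \<and> sum_list is = r}"
  have comp: "compositions r = (\<Union>l\<in>{0..r}. ?A l)"
    using r length_le_sum_list by (fastforce simp: compositions_def)
  have "eta v r = (\<Sum>l=0..r. \<Sum>is\<in>?A l.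
      mconst ((-1) ^ (length is + 1) / (fact (length is) * of_nat (prod_list is))) * pds is v)"
    unfolding eta_def comp
    by (rule sum.UNION_disjoint) (auto simp: finite_bounded_lists[simplified])
  also have "\<dots> = (\<Sum>l=0..r. - (mconst ((-1) ^ l / fact l) * cpow l r v))"
  proof (rule sum.cong[OF refl])
    fix l
    show "(\<Sum>is\<in>?A l. mconst ((-1) ^ (length is + 1) / (fact (length is) * of_nat (prod_list is))) * pds is v)
        = - (mconst ((-1) ^ l / fact l) * cpow l r v)"
      unfolding cpow_pds sum_distrib_left sum_negf[symmetric]
      by (rule sum.cong)
         (auto simp: mult.assoc[symmetric] mconst_mult[symmetric] mconst_uminus)
  qed
  finally show ?thesis by (simp add: shift_def sum_negf)
qed

section \<open>The KP hierarchy\<close>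

definition exp_coeff :: "nat \<Rightarrow> complex mvps" where
  "exp_coeff l = mconst (1 / fact l)"

lemma exp_coeffs_exp_coeff: "exp_coeffs exp_coeff"
proof
  fix l
  show "of_nat (Suc l) * exp_coeff (Suc l) = exp_coeff l"
    unfolding exp_coeff_def mconst_of_nat[symmetric] mconst_mult[symmetric]
    by (simp del: of_nat_Suc)
qed (simp add: exp_coeff_def)

interpretation ec: exp_coeffs exp_coeff by (rule exp_coeffs_exp_coeff)

lemma eta_series_0: "eta_series v $ 0 = 0"
  by (simp add: eta_series_def)

lemma exp_series_exp_coeff: "exp_series = Abs_fps exp_coeff"
  by (simp add: exp_series_def exp_coeff_def[abs_def])

lemma xi_fexp: "Abs_fps (xi v) = ec.fexp (eta_series v)"
  by (rule fps_ext) (simp add: xi_def ec.fexp_def exp_series_exp_coeff)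

text \<open>Read off from \<open>w' = w \<eta>'\<close> for \<open>w = exp \<eta>\<close>, the
  derivative being with respect to \<open>k^-1\<close>.\<close>

lemma xi_euler: "of_nat (Suc j) * xi v (Suc j) = (\<Sum>i=0..j. xi v i * (of_nat (Suc (j - i)) * eta v (Suc (j - i))))"
proof -
  have "fps_deriv (Abs_fps (xi v)) = Abs_fps (xi v) * fps_deriv (eta_series v)"
    unfolding xi_fexp by (rule ec.fps_deriv_fexp) (rule eta_series_0)
  then have "fps_deriv (Abs_fps (xi v)) $ j = (Abs_fps (xi v) * fps_deriv (eta_series v)) $ j"
    by simp
  then show ?thesis
    by (simp add: fps_mult_nth eta_series_def)
qed

lemma xi_1: "xi v (Suc 0) = pd 1 v"
  using xi_euler[of 0 v] shift_rec[of 1 "-1" v] by (simp add: xi_0 eta_shift mconst_uminus)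

lemma shift_xi_0: "r > 0 \<Longrightarrow> shift a r (xi v 0) = 0"
  using shift_mconst[of r a 1] by (simp add: xi_0)

section \<open>Differential operators applied to the wave function\<close>

lemma psi_nth: "fls_nth (psi v) x = (if x < 0 then 0 else xi v (nat x))"
  by (simp add: psi_def)

text \<open>Index \<open>x\<close> belongs to \<open>k^-x\<close>, so multiplication by
  \<open>k^l\<close> reads the coefficient at \<open>x + l\<close>.\<close>

lemma wave_pd_nth: "fls_nth (wave_pd l g) x = fls_nth g (x + int l) + pd l (fls_nth g x)"
  by (simp add: wave_pd_def fls_X_inv_power_times_conv_shift)

lemma wave_pd_zero [simp]: "wave_pd l 0 = 0"
  by (rule fls_eqI) (simp add: wave_pd_nth)

lemma wave_pd_add: "wave_pd l (g + h) = wave_pd l g + wave_pd l h"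
  by (rule fls_eqI) (simp add: wave_pd_nth pd_add)

lemma wave_pd_const_mult:
  "wave_pd l (fls_const f * g) = fls_const f * wave_pd l g + fls_const (pd l f) * g"
  by (rule fls_eqI) (simp add: wave_pd_nth pd_mult distrib_left add.assoc add.commute[of "pd l f * _"])

lemma wave_pd_commute: "wave_pd l (wave_pd m g) = wave_pd m (wave_pd l g)"
  by (rule fls_eqI) (simp add: wave_pd_nth pd_add add.assoc pd_commute[of l] add.left_commute add.commute[of "int l"])

lemma wave_pd_funpow_commute: "wave_pd l ((wave_pd m ^^ j) g) = (wave_pd m ^^ j) (wave_pd l g)"
  by (induction j) (simp_all add: wave_pd_commute[of l])

text \<open>The leading coefficient 1 lets the order of an operator be read off from the powers of
  \<open>k\<close>; the second coefficient does not depend on \<open>j\<close>, which later excludes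
  a term of order \<open>l - 1\<close> from \<open>L_l\<close>.\<close>

lemma psi_deriv_nth:
  "(\<forall>x. x < - int j \<longrightarrow> fls_nth ((wave_pd 1 ^^ j) (psi v)) x = 0)
   \<and> fls_nth ((wave_pd 1 ^^ j) (psi v)) (- int j) = 1
   \<and> fls_nth ((wave_pd 1 ^^ j) (psi v)) (1 - int j) = xi v 1"
proof (induction j)
  case (Suc j)
  moreover have "- int (Suc j) + 1 = - int j" "1 - int (Suc j) = - int j" by simp_all
  ultimately show ?case by (auto simp: wave_pd_nth)
qed (simp add: psi_nth xi_0)

text \<open>The differential operators in \<open>\<partial>\<close> applied to \<open>\<psi>\<close>.\<close>

inductive_set dops :: "complex mvps \<Rightarrow> complex mvps fls set" for v where
  zero: "0 \<in> dops v"
| step: "g \<in> dops v \<Longrightarrow> fls_const f * (wave_pd 1 ^^ j) (psi v) + g \<in> dops v"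

lemma dops_add: "g \<in> dops v \<Longrightarrow> h \<in> dops v \<Longrightarrow> g + h \<in> dops v"
  by (induction rule: dops.induct) (simp_all only: add.assoc add_0_left dops.step)

lemma dops_const_mult: "g \<in> dops v \<Longrightarrow> fls_const f * g \<in> dops v"
proof (induction rule: dops.induct)
  case (step g f' j)
  have "fls_const f * (fls_const f' * (wave_pd 1 ^^ j) (psi v) + g)
      = fls_const (f * f') * (wave_pd 1 ^^ j) (psi v) + fls_const f * g"
    by (simp add: distrib_left mult.assoc flip: fls_const_mult_const)
  then show ?case using step by (simp only: dops.intros)
qed (simp add: dops.zero)

lemma dops_uminus: "g \<in> dops v \<Longrightarrow> - g \<in> dops v"
proof -
  have "- g = fls_const (- 1) * g" by (rule fls_eqI) simp
  then show "g \<in> dops v \<Longrightarrow> - g \<in> dops v" by (simp only: dops_const_mult)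
qed

lemma dops_sum: "(\<And>x. x \<in> A \<Longrightarrow> g x \<in> dops v) \<Longrightarrow> (\<Sum>x\<in>A. g x) \<in> dops v"
  by (induction A rule: infinite_finite_induct) (simp_all add: dops.zero dops_add)

lemma psi_deriv_dops: "(wave_pd 1 ^^ j) (psi v) \<in> dops v"
  using dops.step[OF dops.zero, of 1 j v] by simp

lemma dops_wave_pd_1: "g \<in> dops v \<Longrightarrow> wave_pd 1 g \<in> dops v"
proof (induction rule: dops.induct)
  case (step g f j)
  have "fls_const f * (wave_pd 1 ^^ Suc j) (psi v)
      + fls_const (pd 1 f) * (wave_pd 1 ^^ j) (psi v) + wave_pd 1 g \<in> dops v"
    by (intro dops_add dops_const_mult psi_deriv_dops step)
  then show ?case by (simp add: wave_pd_add wave_pd_const_mult)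
qed (simp add: dops.zero)

text \<open>\<open>\<partial>_l\<close> commutes with \<open>\<partial>\<close>, so apart from
  differentiated coefficients only \<open>\<partial>_l \<psi>\<close> has to be known.\<close>

lemma dops_wave_pd:
  assumes "wave_pd l (psi v) \<in> dops v" "g \<in> dops v"
  shows "wave_pd l g \<in> dops v"
  using assms(2)
proof (induction rule: dops.induct)
  case (step g f j)
  have "(wave_pd 1 ^^ j) (wave_pd l (psi v)) \<in> dops v"
    using assms(1) by (induction j) (simp_all add: dops_wave_pd_1[simplified])
  then have "fls_const f * (wave_pd 1 ^^ j) (wave_pd l (psi v))
      + fls_const (pd l f) * (wave_pd 1 ^^ j) (psi v) + wave_pd l g \<in> dops v"
    by (intro dops_add dops_const_mult psi_deriv_dops step)
  then show ?case by (simp add: wave_pd_add wave_pd_const_mult wave_pd_funpow_commute)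
qed (simp add: dops.zero)

lemma dops_normal_form:
  "g \<in> dops v \<Longrightarrow> \<exists>D f. g = (\<Sum>j=0..D. fls_const (f j) * (wave_pd 1 ^^ j) (psi v))"
proof (induction rule: dops.induct)
  case zero
  show ?case by (rule exI[of _ 0], rule exI[of _ "\<lambda>_. 0"]) simp
next
  case (step g f j)
  then obtain D h where g: "g = (\<Sum>i=0..D. fls_const (h i) * (wave_pd 1 ^^ i) (psi v))" by blast
  let ?h = "\<lambda>i. (if i = j then f else 0) + (if i \<le> D then h i else 0)"
  have "(\<Sum>i=0..max D j. fls_const (?h i) * (wave_pd 1 ^^ i) (psi v))
      = (\<Sum>i=0..max D j. fls_const (if i = j then f else 0) * (wave_pd 1 ^^ i) (psi v))
      + (\<Sum>i=0..max D j. fls_const (if i \<le> D then h i else 0) * (wave_pd 1 ^^ i) (psi v))"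
    by (simp add: distrib_right sum.distrib flip: fls_plus_const)
  also have "(\<Sum>i=0..max D j. fls_const (if i = j then f else 0) * (wave_pd 1 ^^ i) (psi v))
      = (\<Sum>i\<in>{j}. fls_const f * (wave_pd 1 ^^ i) (psi v))"
    by (rule sum.mono_neutral_cong_right) auto
  also have "(\<Sum>i=0..max D j. fls_const (if i \<le> D then h i else 0) * (wave_pd 1 ^^ i) (psi v)) = g"
    unfolding g by (rule sum.mono_neutral_cong_right) auto
  finally have "fls_const f * (wave_pd 1 ^^ j) (psi v) + g
      = (\<Sum>i=0..max D j. fls_const (?h i) * (wave_pd 1 ^^ i) (psi v))"
    by simp
  then show ?case by (intro exI)
qed

text \<open>At \<open>k^D\<close> only the summand of top order \<open>D\<close> contributes, with
  coefficient \<open>f D\<close>. If \<open>D > d\<close> it must vanish, so orders are removed from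
  the top.\<close>

lemma dops_order:
  assumes "g \<in> dops v" and low: "\<And>x. x < - int d \<Longrightarrow> fls_nth g x = 0"
  obtains f where "g = (\<Sum>j=0..d. fls_const (f j) * (wave_pd 1 ^^ j) (psi v))"
proof -
  let ?G = "\<lambda>D f. \<Sum>j=0..D. fls_const (f j) * (wave_pd 1 ^^ j) (psi v)"
  have "\<exists>f'. ?G D f = ?G d f'" if "\<And>x. x < - int d \<Longrightarrow> fls_nth (?G D f) x = 0" for D f
    using that
  proof (induction D)
    case 0
    have "?G 0 f = ?G d (\<lambda>j. if j = 0 then f 0 else 0)"
      by (rule sum.mono_neutral_cong_left) auto
    then show ?case by (rule exI[of _ "\<lambda>j. if j = 0 then f 0 else 0"])
  next
    case (Suc D)
    show ?case
    proof (cases "D < d")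
      case True
      have "?G (Suc D) f = ?G d (\<lambda>j. if j \<le> Suc D then f j else 0)"
        using True by (intro sum.mono_neutral_cong_left) auto
      then show ?thesis by (rule exI[of _ "\<lambda>j. if j \<le> Suc D then f j else 0"])
    next
      case False
      have "0 = fls_nth (?G (Suc D) f) (- int (Suc D))"
        using Suc.prems[of "- int (Suc D)"] False by simp
      also have "\<dots> = (\<Sum>j\<in>{0..Suc D}. f j * fls_nth ((wave_pd 1 ^^ j) (psi v)) (- int (Suc D)))"
        by (simp only: fls_nth_sum fls_mult_const_nth)
      also have "\<dots> = (\<Sum>j\<in>{Suc D}. f j * fls_nth ((wave_pd 1 ^^ j) (psi v)) (- int (Suc D)))"
      proof (rule sum.mono_neutral_right)
        show "\<forall>j\<in>{0..Suc D} - {Suc D}. f j * fls_nth ((wave_pd 1 ^^ j) (psi v)) (- int (Suc D)) = 0"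
        proof
          fix j assume "j \<in> {0..Suc D} - {Suc D}"
          then have "- int (Suc D) < - int j" by auto
          then show "f j * fls_nth ((wave_pd 1 ^^ j) (psi v)) (- int (Suc D)) = 0"
            using psi_deriv_nth[of j v] by (metis mult_zero_right)
        qed
      qed auto
      also have "\<dots> = f (Suc D)"
        using psi_deriv_nth[of "Suc D" v] by (simp del: funpow.simps of_nat_Suc)
      finally have "?G (Suc D) f = ?G D f" by simp
      with Suc show ?thesis by metis
    qed
  qed
  moreover obtain D f where "g = ?G D f" using dops_normal_form[OF assms(1)] by blast
  ultimately obtain f' where "g = ?G d f'" using low by blast
  then show ?thesis by (rule that)
qed

text \<open>
  \<open>wave_shift v r\<close> is the coefficient of \<open>y\<^sup>r\<close> in the shift \<open>x\<^sub>i \<mapsto> x\<^sub>i - y\<^sup>i / i\<close> of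
  \<open>\<psi>\<close>, whose exponential factor changes by \<open>1 - k y\<close>.
\<close>

definition wave_shift :: "complex mvps \<Rightarrow> nat \<Rightarrow> complex mvps fls" where
  "wave_shift v r = fps_to_fls (fps_map (shift (-1) r) (Abs_fps (xi v)))
     - (if r = 0 then 0 else fls_X_inv * fps_to_fls (fps_map (shift (-1) (r - 1)) (Abs_fps (xi v))))"

lemma wave_shift_nth:
  "fls_nth (wave_shift v r) x = shift (-1) r (fls_nth (psi v) x)
     - (if r = 0 then 0 else shift (-1) (r - 1) (fls_nth (psi v) (x + 1)))"
  by (auto simp: wave_shift_def psi_def fls_X_inv_times_conv_shift)

lemma wave_shift_0: "wave_shift v 0 = psi v"
  by (rule fls_eqI) (simp add: wave_shift_nth)

lemma wave_shift_1: "wave_shift v (Suc 0) = - wave_pd 1 (psi v)"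
  by (rule fls_eqI) (use shift_rec[of 1 "-1"] in \<open>simp add: wave_shift_nth wave_pd_nth mconst_uminus\<close>)

text \<open>The shift recursion with scalar \<open>-1\<close> for the whole of
  \<open>\<psi>\<close>, each \<open>\<partial>_i\<close> acting as \<open>wave_pd i\<close>; the
  contributions of \<open>k^i\<close> telescope because of the factor
  \<open>1 - k y\<close>.\<close>

lemma wave_shift_rec: "of_nat r * wave_shift v r = - (\<Sum>i=1..r. wave_pd i (wave_shift v (r - i)))"
proof (cases r)
  case (Suc q)
  show ?thesis
  proof (rule fls_eqI)
    fix x
    let ?s = "shift (-1)"
    let ?w = "\<lambda>x. fls_nth (psi v) x"
    have "(\<Sum>i=1..r. fls_nth (wave_shift v (r - i)) (x + int i)) = ?s q (?w (x + 1))"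
    proof -
      have "(\<Sum>i=1..r. fls_nth (wave_shift v (r - i)) (x + int i))
          = (\<Sum>i=0..q. fls_nth (wave_shift v (q - i)) (x + int i + 1))"
        unfolding Suc by (rule sum.reindex_bij_witness[of _ Suc "\<lambda>i. i - 1"]) (auto simp: algebra_simps)
      also have "\<dots> = ?s q (?w (x + 1))"
      proof -
        \<comment> \<open>Downward induction on the lower limit: the summands are differences of
          neighbours, and only the leading part of the first survives.\<close>
        have "(\<Sum>i=p..q. fls_nth (wave_shift v (q - i)) (x + int i + 1)) = ?s (q - p) (?w (x + int p + 1))"
          if "p \<le> q" for p
          using that
        proof (induction p rule: inc_induct)
          case (step p)
          have "(\<Sum>i=p..q. fls_nth (wave_shift v (q - i)) (x + int i + 1))
              = fls_nth (wave_shift v (q - p)) (x + int p + 1)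
                + (\<Sum>i=Suc p..q. fls_nth (wave_shift v (q - i)) (x + int i + 1))"
            using step(2) by (simp add: sum.atLeast_Suc_atMost)
          then show ?case unfolding step(3) using step(2)
            by (simp add: wave_shift_nth algebra_simps)
        qed (simp add: wave_shift_nth)
        from this[of 0] show ?thesis by simp
      qed
      finally show ?thesis .
    qed
    moreover have "(\<Sum>i=1..r. pd i (fls_nth (wave_shift v (r - i)) x))
        = (\<Sum>i=1..r. pd i (?s (r - i) (?w x))) - (\<Sum>i=1..q. pd i (?s (q - i) (?w (x + 1))))"
    proof -
      have "(\<Sum>i=1..r. pd i (fls_nth (wave_shift v (r - i)) x))
          = (\<Sum>i=1..r. pd i (?s (r - i) (?w x)))
            - (\<Sum>i=1..r. if i = r then 0 else pd i (?s (q - i) (?w (x + 1))))"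
        unfolding sum_subtractf[symmetric]
      proof (rule sum.cong[OF refl])
        fix i assume "i \<in> {1..r}"
        then have "i \<noteq> r \<Longrightarrow> r - i - 1 = q - i" "i \<noteq> r \<Longrightarrow> r - i \<noteq> 0" using Suc by auto
        then show "pd i (fls_nth (wave_shift v (r - i)) x) = pd i (?s (r - i) (?w x))
            - (if i = r then 0 else pd i (?s (q - i) (?w (x + 1))))"
          by (auto simp: wave_shift_nth pd_diff)
      qed
      also have "(\<Sum>i=1..r. if i = r then 0 else pd i (?s (q - i) (?w (x + 1))))
          = (\<Sum>i=1..q. pd i (?s (q - i) (?w (x + 1))))"
        by (rule sum.mono_neutral_cong_right) (auto simp: Suc)
      finally show ?thesis .
    qed
    ultimately have "fls_nth (- (\<Sum>i=1..r. wave_pd i (wave_shift v (r - i)))) x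
        = - ?s q (?w (x + 1)) + of_nat r * ?s r (?w x) - of_nat q * ?s q (?w (x + 1))"
      unfolding shift_rec
      by (simp add: fls_nth_sum wave_pd_nth sum.distrib mconst_uminus)
    also have "\<dots> = of_nat r * fls_nth (wave_shift v r) x"
      by (simp add: wave_shift_nth Suc algebra_simps)
    finally show "fls_nth (of_nat r * wave_shift v r) x
        = fls_nth (- (\<Sum>i=1..r. wave_pd i (wave_shift v (r - i)))) x"
      by simp
  qed
qed simp

section \<open>The KP hierarchy in terms of the shifted wave function\<close>

definition shift_eqs :: "complex mvps \<Rightarrow> bool" where
  "shift_eqs v \<longleftrightarrow> (\<forall>r\<ge>1. \<forall>j. shift (-1) r (xi v (Suc j))
     = shift (-1) (Suc r) (xi v j) + pd 1 (shift (-1) r v) * xi v j)"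

text \<open>Comparison of coefficients at \<open>k^-j\<close>. At positive powers of
  \<open>k\<close> both sides vanish, at \<open>k^1\<close> because \<open>xi v 0\<close> is
  constant and \<open>r - 1 > 0\<close>.\<close>

lemma shift_eqs_wave_shift:
  "shift_eqs v \<longleftrightarrow> (\<forall>r\<ge>2. wave_shift v r = fls_const (- pd 1 (shift (-1) (r - 1) v)) * psi v)"
  (is "_ = ?R")
proof
  assume eqs: "shift_eqs v"
  show ?R
  proof (intro allI impI fls_eqI)
    fix r :: nat and x assume r: "r \<ge> 2"
    then obtain q where q: "r = Suc q" "q \<ge> 1" by (cases r) auto
    consider "x < -1" | "x = -1" | j where "x = int j"
    proof -
      have "x < -1 \<or> x = -1 \<or> x = int (nat x)" by linarith
      then show thesis using that by blast
    qed
    then show "fls_nth (wave_shift v r) x = fls_nth (fls_const (- pd 1 (shift (-1) (r - 1) v)) * psi v) x"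
    proof cases
      case 3
      then have "nat (x + 1) = Suc j" by simp
      with 3 eqs q show ?thesis
        by (simp add: wave_shift_nth psi_nth shift_eqs_def)
    qed (use q in \<open>simp_all add: wave_shift_nth psi_nth shift_xi_0\<close>)
  qed
next
  assume R: ?R
  show "shift_eqs v"
    unfolding shift_eqs_def
  proof (intro allI impI)
    fix r j :: nat assume r: "r \<ge> 1"
    have "wave_shift v (Suc r) = fls_const (- pd 1 (shift (-1) r v)) * psi v"
      using R[rule_format, of "Suc r"] r by simp
    then have "fls_nth (wave_shift v (Suc r)) (int j) = fls_nth (fls_const (- pd 1 (shift (-1) r v)) * psi v) (int j)"
      by simp
    moreover have "nat (int j + 1) = Suc j" by simp
    ultimately show "shift (-1) r (xi v (Suc j)) = shift (-1) (Suc r) (xi v j) + pd 1 (shift (-1) r v) * xi v j"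
      by (simp add: wave_shift_nth psi_nth algebra_simps)
  qed
qed

lemma KP_solution_imp_shift_eqs:
  assumes "KP_solution v"
  shows "shift_eqs v"
  unfolding shift_eqs_wave_shift
proof (intro allI impI)
  have wave: "wave_pd l (psi v) \<in> dops v" if l: "l \<ge> 1" for l
  proof -
    obtain B where B: "wave_pd l (psi v) = (wave_pd 1 ^^ l) (psi v)
        + (\<Sum>i = 2..l. fls_const (B i) * (wave_pd 1 ^^ (l - i)) (psi v))"
      using assms l unfolding KP_solution_def by blast
    show ?thesis unfolding B by (intro dops_add dops_sum dops_const_mult psi_deriv_dops)
  qed
  have shift: "wave_shift v r \<in> dops v" for r
  proof (induction r rule: less_induct)
    case (less r)
    show ?case
    proof (cases "r = 0")
      case True
      then show ?thesis using psi_deriv_dops[of 0 v] by (simp add: wave_shift_0)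
    next
      case False
      have "fls_const (mconst (1 / of_nat r)) * - (\<Sum>i=1..r. wave_pd i (wave_shift v (r - i))) \<in> dops v"
        by (intro dops_const_mult dops_uminus dops_sum dops_wave_pd[OF wave] less) (use False in auto)
      also have "fls_const (mconst (1 / of_nat r)) * - (\<Sum>i=1..r. wave_pd i (wave_shift v (r - i)))
          = wave_shift v r"
        unfolding wave_shift_rec[symmetric] fls_of_nat using False
        by (intro fls_eqI)
           (simp add: mult.assoc[symmetric] mconst_of_nat[symmetric] mconst_mult[symmetric])
      finally show ?thesis .
    qed
  qed
  fix r :: nat assume r: "r \<ge> 2"
  have low: "fls_nth (wave_shift v r) x = 0" if "x < - int 0" for x
  proof (cases "x = -1")
    case True
    with r show ?thesis by (simp add: wave_shift_nth psi_nth shift_xi_0)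
  next
    case False
    with that r show ?thesis by (simp add: wave_shift_nth psi_nth)
  qed
  obtain f where "wave_shift v r = (\<Sum>j=0..0. fls_const (f j) * (wave_pd 1 ^^ j) (psi v))"
    by (rule dops_order[OF shift low])
  then have f: "wave_shift v r = fls_const (f 0) * psi v" by simp
  \<comment> \<open>\<open>\<psi>\<close> has coefficient 1 at \<open>k^0\<close>, so the factor is
    the coefficient there; it comes from \<open>xi v 1 = \<partial> v\<close>.\<close>
  have "f 0 = fls_nth (wave_shift v r) 0"
    unfolding f by (simp add: psi_nth xi_0)
  also have "\<dots> = - pd 1 (shift (-1) (r - 1) v)"
    using r by (simp add: wave_shift_nth psi_nth shift_xi_0 xi_1[simplified] pd_shift)
  finally show "wave_shift v r = fls_const (- pd 1 (shift (-1) (r - 1) v)) * psi v"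
    using f by simp
qed

text \<open>All shift coefficients of \<open>\<psi>\<close> are now operators in
  \<open>\<partial>\<close> applied to \<open>\<psi>\<close>. Solving \<open>wave_shift_rec\<close>
  for the term with \<open>wave_pd l\<close> gives the same for \<open>\<partial>_l \<psi>\<close>,
  by induction on \<open>l\<close>.\<close>

lemma shift_eqs_imp_KP_solution:
  assumes "shift_eqs v"
  shows "KP_solution v"
proof -
  have shift: "wave_shift v r \<in> dops v" for r
  proof -
    consider "r = 0" | "r = 1" | "r \<ge> 2" by linarith
    then show ?thesis
    proof cases
      case 3
      then have "wave_shift v r = fls_const (- pd 1 (shift (-1) (r - 1) v)) * psi v"
        using assms unfolding shift_eqs_wave_shift by blast
      then show ?thesis
        using dops_const_mult[OF psi_deriv_dops[of 0 v]] by (simp only: funpow_0)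
    next
      case 2
      then show ?thesis
        using dops_uminus[OF psi_deriv_dops[of 1 v]] by (simp add: wave_shift_1[simplified])
    qed (use psi_deriv_dops[of 0 v] in \<open>simp add: wave_shift_0\<close>)
  qed
  have wave: "wave_pd l (psi v) \<in> dops v" if "l \<ge> 1" for l
    using that
  proof (induction l rule: less_induct)
    case (less l)
    then obtain q where l: "l = Suc q" by (cases l) auto
    have "wave_pd l (psi v) = - fls_const (of_nat l) * wave_shift v l
        + - (\<Sum>i=1..q. wave_pd i (wave_shift v (l - i)))"
      using wave_shift_rec[of l v]
      by (simp add: l wave_shift_0 fls_of_nat del: of_nat_Suc)
    also have "\<dots> = fls_const (- of_nat l) * wave_shift v l + - (\<Sum>i=1..q. wave_pd i (wave_shift v (l - i)))"
      by simp
    also have "\<dots> \<in> dops v"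
      by (intro dops_add dops_uminus dops_sum dops_const_mult dops_wave_pd[OF less.IH] shift) (auto simp: l)
    finally show ?case .
  qed
  show ?thesis
    unfolding KP_solution_def
  proof (intro allI impI)
    fix l :: nat assume l: "l \<ge> 1"
    show "\<exists>B. wave_pd l (psi v) = (wave_pd 1 ^^ l) (psi v)
        + (\<Sum>i = 2..l. fls_const (B i) * (wave_pd 1 ^^ (l - i)) (psi v))"
    proof (cases "l = 1")
      case True
      then show ?thesis by simp
    next
      case False
      define d where "d = l - 2"
      with l False have l2: "l = d + 2" by simp
      \<comment> \<open>The two leading coefficients, 1 and \<open>xi v 1\<close>, cancel, which
        leaves an operator of order at most \<open>l - 2\<close>.\<close>
      let ?g = "wave_pd l (psi v) + - (wave_pd 1 ^^ l) (psi v)"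
      have g: "?g \<in> dops v"
        by (intro dops_add dops_uminus wave l psi_deriv_dops)
      have low: "fls_nth ?g x = 0" if x: "x < - int d" for x
      proof -
        consider "x < - int l" | "x = - int l" | "x = 1 - int l" using x l2 by linarith
        then show ?thesis
          using psi_deriv_nth[of l v] x by cases (simp_all add: wave_pd_nth psi_nth xi_0 del: funpow.simps)
      qed
      obtain f where f: "?g = (\<Sum>j=0..d. fls_const (f j) * (wave_pd 1 ^^ j) (psi v))"
        by (rule dops_order[OF g low])
      also have "\<dots> = (\<Sum>i=2..l. fls_const (f (l - i)) * (wave_pd 1 ^^ (l - i)) (psi v))"
        by (rule sum.reindex_bij_witness[of _ "\<lambda>i. l - i" "\<lambda>i. l - i"]) (auto simp: l2)
      finally show ?thesis by (intro exI[of _ "\<lambda>i. f (l - i)"]) (simp add: algebra_simps)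
    qed
  qed
qed

theorem KP_solution_iff_shift_eqs: "KP_solution v \<longleftrightarrow> shift_eqs v"
  using KP_solution_imp_shift_eqs shift_eqs_imp_KP_solution by blast

section \<open>The differential Fay identity\<close>

text \<open>
  In \<open>complex mvps fps fps\<close> the outer variable is \<open>z = k\<^bsup>-1\<^esup>\<close> and the inner variable
  \<open>y = \<lambda>\<^bsup>-1\<^esup>\<close>, so that \<open>F $ j $ i\<close> is the coefficient of \<open>y\<^sup>i z\<^sup>j\<close>.
\<close>

lemma exp_coeffs_fps_const: "exp_coeffs (\<lambda>l. fps_const (exp_coeff l))"
proof
  fix l
  show "of_nat (Suc l) * fps_const (exp_coeff (Suc l)) = fps_const (exp_coeff l)"
    unfolding fps_of_nat[symmetric] using ec.c_Suc[of l] by (simp del: of_nat_Suc)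
qed (simp add: ec.c_0)

interpretation ec2: exp_coeffs "\<lambda>l. fps_const (exp_coeff l)"
  by (rule exp_coeffs_fps_const)

interpretation shift2: hasse_schmidt "\<lambda>m. fps_map (shift a m)" for a
  by (rule shift.hasse_schmidt_fps_map)

text \<open>\<open>shift2.total\<close> shifts with the outer variable, the coefficientwise
  \<open>shift.total\<close> with the inner one; both variables stay fixed.\<close>

definition shift_total :: "complex \<Rightarrow> complex mvps fps fps \<Rightarrow> complex mvps fps fps" where
  "shift_total a F = fps_map (shift.total a) (shift2.total a F)"

lemma shift_total_nth:
  "shift_total a F $ j $ i = (\<Sum>p=0..i. \<Sum>q=0..j. shift a (i - p) (shift a (j - q) (F $ q $ p)))"
  by (simp add: shift_total_def shift.total_nth shift2.total_nth fps_sum_nth shift_sum)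

lemma shift_total_add: "shift_total a (F + G) = shift_total a F + shift_total a G"
  by (rule fps_ext)+ (simp add: shift_total_nth shift_add sum.distrib)

lemma shift_total_uminus: "shift_total a (- F) = - shift_total a F"
  by (rule fps_ext)+ (simp add: shift_total_nth shift_uminus sum_negf)

lemma shift_total_diff: "shift_total a (F - G) = shift_total a F - shift_total a G"
  using shift_total_add[of a F "- G"] by (simp add: shift_total_uminus)

lemma shift_total_mult: "shift_total a (F * G) = shift_total a F * shift_total a G"
proof (rule fps_ext)
  fix j
  have total_sum: "shift.total a (\<Sum>x\<in>A. f x) = (\<Sum>x\<in>A. shift.total a (f x))" for f and A :: "nat set"
  proof (induction A rule: infinite_finite_induct)
    case (insert x A)
    then show ?case by (simp add: shift.total_add)
  qed (rule fps_ext, simp add: shift.total_nth)+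
  show "shift_total a (F * G) $ j = (shift_total a F * shift_total a G) $ j"
    by (simp add: shift_total_def shift2.total_mult fps_mult_nth total_sum shift.total_mult)
qed

lemma shift_total_const:
  assumes "\<And>i j. \<exists>c. F $ j $ i = mconst c"
  shows "shift_total a F = F"
proof (rule fps_ext, rule fps_ext)
  fix j i
  have 0: "shift a m (F $ q $ p) = 0" if "m > 0" for m p q
    using assms[where i = p and j = q] shift_mconst[OF that] by metis
  have "shift_total a F $ j $ i = (\<Sum>p\<in>{i}. \<Sum>q=0..j. shift a (i - p) (shift a (j - q) (F $ q $ p)))"
    unfolding shift_total_nth
    by (rule sum.mono_neutral_right) (auto simp: shift_commute[of a _ a "j - _"] 0 intro!: sum.neutral)
  also have "\<dots> = (\<Sum>q=0..j. shift a (j - q) (F $ q $ i))"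
    by simp
  also have "\<dots> = (\<Sum>q\<in>{j}. shift a (j - q) (F $ q $ i))"
    by (rule sum.mono_neutral_right) (auto simp: 0)
  finally show "shift_total a F $ j $ i = F $ j $ i" by simp
qed

lemma shift_total_1: "shift_total a 1 = 1"
proof (rule shift_total_const)
  show "\<exists>c. 1 $ j $ i = mconst c" for i j
    by (rule exI[of _ "if j = 0 \<and> i = 0 then 1 else 0"]) auto
qed

lemma shift_total_fexp:
  assumes "F $ 0 = 0"
  shows "shift_total a (ec2.fexp F) = ec2.fexp (shift_total a F)"
proof (rule fexp_hom[OF ec2.exp_coeffs_axioms ec2.exp_coeffs_axioms])
  show "shift_total a (fps_const (fps_const (exp_coeff l))) = fps_const (fps_const (exp_coeff l))" for l
    by (rule shift_total_const) (auto simp: exp_coeff_def intro: exI[of _ 0] mconst_0[symmetric])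
  show "shift_total a F $ k = 0" if "\<And>i. i \<le> k \<Longrightarrow> F $ i = 0" for F k
    by (rule fps_ext) (simp add: shift_total_nth that)
qed (simp_all add: shift_total_1 shift_total_add shift_total_mult assms)

definition shift_series :: "complex \<Rightarrow> complex \<Rightarrow> complex mvps \<Rightarrow> complex mvps fps fps" where
  "shift_series a b f = Abs_fps (\<lambda>j. Abs_fps (\<lambda>i. shift a i (shift b j f)))"

lemma shift_total_series: "shift_total c (shift_series a b f) = shift_series (c + a) (c + b) f"
proof (rule fps_ext, rule fps_ext)
  fix j i
  have "shift_total c (shift_series a b f) $ j $ i
      = (\<Sum>p=0..i. shift c (i - p) (shift a p (\<Sum>q=0..j. shift c (j - q) (shift b q f))))"
    by (simp add: shift_total_nth shift_series_def shift_sum shift_commute[of c _ a])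
  also have "\<dots> = shift (c + a) i (shift (c + b) j f)"
    by (simp only: shift_shift)
  finally show "shift_total c (shift_series a b f) $ j $ i = shift_series (c + a) (c + b) f $ j $ i"
    by (simp add: shift_series_def)
qed

text \<open>
  With \<open>E\<^sub>y = exp (\<Sum>i. y\<^sup>i \<partial>\<^sub>i / i)\<close>, the series \<open>fay_H a b v\<close> is
  \<open>- (E\<^sub>y\<^sup>a - E\<^sub>y\<^sup>b) (E\<^sub>z\<^sup>a - E\<^sub>z\<^sup>b) v\<close> and \<open>fay_X a b v\<close> is the quotient of
  \<open>(E\<^sub>y\<^sup>a E\<^sub>z\<^sup>b - E\<^sub>y\<^sup>b E\<^sub>z\<^sup>a) \<partial>v\<close> by \<open>\<lambda> - k = y\<^sup>-\<^sup>1 - z\<^sup>-\<^sup>1\<close>.  The differential Fay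
  identity is the case \<open>(a, b) = (0, -1)\<close>; applying \<open>E\<^sub>y\<^sup>c E\<^sub>z\<^sup>c\<close> moves it to \<open>(a + c, b + c)\<close>, and
  for \<open>(1/2, -1/2)\<close> only even orders of differentiation occur.
\<close>

definition fay_H :: "complex \<Rightarrow> complex \<Rightarrow> complex mvps \<Rightarrow> complex mvps fps fps" where
  "fay_H a b v = - (shift_series a a v - shift_series a b v - shift_series b a v + shift_series b b v)"

definition fay_Q :: "complex \<Rightarrow> complex \<Rightarrow> complex mvps \<Rightarrow> nat \<Rightarrow> nat \<Rightarrow> complex mvps" where
  "fay_Q a b v p q = shift a p (shift b q (pd 1 v)) - shift b p (shift a q (pd 1 v))"

definition fay_X :: "complex \<Rightarrow> complex \<Rightarrow> complex mvps \<Rightarrow> complex mvps fps fps" where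
  "fay_X a b v = Abs_fps (\<lambda>j. Abs_fps (\<lambda>i. \<Sum>p<i. fay_Q a b v p (i + j - 1 - p)))"

definition fay :: "complex \<Rightarrow> complex \<Rightarrow> complex mvps \<Rightarrow> bool" where
  "fay a b v \<longleftrightarrow> ec2.fexp (fay_H a b v) = 1 + fay_X a b v"

lemma fay_H_nth:
  "fay_H a b v $ j $ i = - (shift a i (shift a j v) - shift a i (shift b j v)
     - shift b i (shift a j v) + shift b i (shift b j v))"
  by (simp add: fay_H_def shift_series_def)

lemma fay_H_nth_0 [simp]: "fay_H a b v $ 0 = 0"
  by (rule fps_ext) (simp add: fay_H_nth)

lemma fay_H_nth_nth_0 [simp]: "fay_H a b v $ j $ 0 = 0"
  by (simp add: fay_H_nth)

lemma fay_H_sym: "fay_H a b v $ j $ i = fay_H a b v $ i $ j"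
  by (simp add: fay_H_nth shift_commute[of _ i])

lemma fay_X_nth: "fay_X a b v $ j $ i = (\<Sum>p<i. fay_Q a b v p (i + j - 1 - p))"
  by (simp add: fay_X_def)

lemma fay_Q_antisym: "fay_Q a b v q p = - fay_Q a b v p q"
  by (simp add: fay_Q_def shift_commute[of _ q])

text \<open>Reversing the antidiagonal changes the sign. This is what makes the numerator of
  \<open>fay_X\<close> divisible by \<open>z - y\<close>.\<close>

lemma fay_Q_sum_0: "(\<Sum>p<m. fay_Q a b v p (m - 1 - p)) = 0"
proof -
  have "(\<Sum>p<m. fay_Q a b v p (m - 1 - p)) = (\<Sum>p<m. - fay_Q a b v p (m - 1 - p))"
    by (rule sum.reindex_bij_witness[of _ "\<lambda>p. m - 1 - p" "\<lambda>p. m - 1 - p"])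
       (auto simp: fay_Q_antisym[symmetric])
  then have "of_nat (Suc 1) * (\<Sum>p<m. fay_Q a b v p (m - 1 - p)) = 0"
    by (simp add: sum_negf algebra_simps)
  then show ?thesis by (rule of_nat_Suc_mult_eq_0)
qed

text \<open>The \<open>i + j\<close> terms of a full antidiagonal cancel; reversing the last
  \<open>j\<close> of them gives minus the sum with \<open>i\<close> and \<open>j\<close>
  exchanged.\<close>

lemma fay_X_sym: "fay_X a b v $ j $ i = fay_X a b v $ i $ j"
proof -
  have "(\<Sum>p<i+j. fay_Q a b v p (i + j - 1 - p))
      = (\<Sum>p<i. fay_Q a b v p (i + j - 1 - p)) + (\<Sum>p<j. fay_Q a b v (j - 1 - p + i) p)"
  proof -
    have "(\<Sum>p<i+j. fay_Q a b v p (i + j - 1 - p))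
      = (\<Sum>p<i. fay_Q a b v p (i + j - 1 - p)) + (\<Sum>p=i..<i+j. fay_Q a b v p (i + j - 1 - p))"
      by (subst sum.union_disjoint[symmetric]) (auto intro!: sum.cong)
    also have "(\<Sum>p=i..<i+j. fay_Q a b v p (i + j - 1 - p)) = (\<Sum>p<j. fay_Q a b v (j - 1 - p + i) p)"
      by (rule sum.reindex_bij_witness[of _ "\<lambda>p. j - 1 - p + i" "\<lambda>p. i + j - 1 - p"]) auto
    finally show ?thesis .
  qed
  also have "(\<Sum>p<j. fay_Q a b v (j - 1 - p + i) p) = - (\<Sum>p<j. fay_Q a b v p (i + j - 1 - p))"
    unfolding sum_negf[symmetric]
    by (rule sum.cong) (auto simp: fay_Q_antisym[symmetric] add.commute)
  finally show ?thesis
    using fay_Q_sum_0[of a b v "i + j"] by (simp add: fay_X_nth add.commute)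
qed

text \<open>The division by \<open>y^-1 - z^-1 = (z - y) / (y z)\<close>, cleared of denominators.
  Neighbouring partial sums on an antidiagonal differ by one \<open>fay_Q\<close>; on the border a
  full antidiagonal has to vanish.\<close>

lemma fay_X_eq:
  "(fps_X - fps_const fps_X) * fay_X a b v
     = fps_X * (fps_const fps_X * (shift_series a b (pd 1 v) - shift_series b a (pd 1 v)))"
proof (rule fps_ext, rule fps_ext)
  fix j i
  show "((fps_X - fps_const fps_X) * fay_X a b v) $ j $ i
     = (fps_X * (fps_const fps_X * (shift_series a b (pd 1 v) - shift_series b a (pd 1 v)))) $ j $ i"
  proof (cases "i = 0 \<or> j = 0")
    case True
    then show ?thesis
      using fay_Q_sum_0[of a b v "i - 1"] by (auto simp: left_diff_distrib fay_X_nth fps_X_mult_nth)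
  next
    case False
    then obtain p q where "i = Suc p" "j = Suc q" by (metis not0_implies_Suc)
    then show ?thesis
      by (simp add: left_diff_distrib fay_X_nth fps_X_mult_nth shift_series_def fay_Q_def[of _ _ _ p])
  qed
qed

text \<open>A series annihilated by \<open>z - y\<close> is constant along antidiagonals, and these
  end at inner degree 0, where it vanishes.\<close>

lemma diff_mult_cancel:
  fixes F G :: "'a :: comm_ring_1 fps fps"
  assumes "(fps_X - fps_const fps_X) * F = (fps_X - fps_const fps_X) * G"
  shows "F = G"
proof -
  define D where "D = F - G"
  have "(fps_X - fps_const fps_X) * D = 0"
    using assms by (simp add: D_def right_diff_distrib)
  then have "((fps_X - fps_const fps_X) * D) $ Suc j $ i = 0" for i j by simp
  then have *: "D $ j $ i = (if i = 0 then 0 else D $ Suc j $ (i - 1))" for i j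
    by (simp add: left_diff_distrib fps_X_mult_nth)
  have "D $ j $ i = 0" for i j
    by (induction i arbitrary: j) (subst *, simp)+
  then have "D = 0" by (intro fps_ext) simp
  then show ?thesis by (simp add: D_def)
qed

lemma shift_total_fay_H: "shift_total c (fay_H a b v) = fay_H (c + a) (c + b) v"
  by (simp add: fay_H_def shift_total_add shift_total_diff shift_total_uminus shift_total_series)

text \<open>The shift fixes \<open>y\<close> and \<open>z\<close>, so both sides solve the equation
  \<open>fay_X_eq\<close>, whose solution is unique.\<close>

lemma shift_total_fay_X: "shift_total c (fay_X a b v) = fay_X (c + a) (c + b) v"
proof (rule diff_mult_cancel)
  have z: "shift_total c fps_X = fps_X" and y: "shift_total c (fps_const fps_X) = fps_const fps_X"
    by (rule shift_total_const, auto simp: fps_X_nth intro: exI[of _ 0] exI[of _ 1])+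
  have "shift_total c ((fps_X - fps_const fps_X) * fay_X a b v)
      = (fps_X - fps_const fps_X) * fay_X (c + a) (c + b) v"
    by (simp only: fay_X_eq shift_total_mult shift_total_diff shift_total_series z y)
  then show "(fps_X - fps_const fps_X) * shift_total c (fay_X a b v)
      = (fps_X - fps_const fps_X) * fay_X (c + a) (c + b) v"
    by (simp only: shift_total_mult shift_total_diff z y)
qed

lemma fay_shift: "fay a b v \<Longrightarrow> fay (c + a) (c + b) v"
proof -
  assume "fay a b v"
  then have "shift_total c (ec2.fexp (fay_H a b v)) = shift_total c (1 + fay_X a b v)"
    by (simp add: fay_def)
  then show ?thesis
    by (simp add: fay_def shift_total_1 shift_total_fexp shift_total_add shift_total_fay_H shift_total_fay_X)
qed

lemma fay_0_iff: "fay 0 (-1) v \<longleftrightarrow> fay (1/2) (-1/2) v"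
  using fay_shift[of 0 "-1" v "1/2"] fay_shift[of "1/2" "-1/2" v "-1/2"] by auto

text \<open>Shifting \<open>w = exp \<eta>\<close> in \<open>y\<close> gives
  \<open>S w = exp (S \<eta>) = w exp (fay_H 0 (-1) v)\<close>. As \<open>w\<close> can be
  cancelled, the Fay identity says \<open>S w = w (1 + fay_X 0 (-1) v)\<close>.\<close>

lemma fay_iff_convolution:
  "fay 0 (-1) v \<longleftrightarrow> (\<forall>i\<ge>1. \<forall>j. shift (-1) i (xi v j)
     = (\<Sum>b<j. xi v b * pd 1 (shift (-1) (i + j - 1 - b) v)))"
proof -
  \<comment> \<open>\<open>S f\<close> is the shift of \<open>f\<close> as a series in the inner
    variable; \<open>?w\<close> is \<open>w\<close> with coefficients constant in that
    variable.\<close>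
  define S where "S = (\<lambda>f. Abs_fps (\<lambda>i. shift (-1) i f))"
  let ?w = "fps_map fps_const (Abs_fps (xi v))" and ?W = "fps_map S (Abs_fps (xi v))"
  let ?h = "fps_map fps_const (eta_series v)"
  have S_add: "S (f + g) = S f + S g" for f g
    by (rule fps_ext) (simp add: S_def shift_add)
  have S_mult: "S (f * g) = S f * S g" for f g
    by (rule fps_ext) (simp add: S_def shift_mult fps_mult_nth)
  have S_mconst: "S (mconst c) = fps_const (mconst c)" for c
    by (rule fps_ext) (simp add: S_def shift_mconst)
  have S_0: "S 0 = 0" and S_1: "S 1 = 1"
    using S_mconst[of 0] S_mconst[of 1] by simp_all
  have S_sum: "S (\<Sum>x\<in>A. f x) = (\<Sum>x\<in>A. S (f x))" for f and A :: "nat set"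
    by (induction A rule: infinite_finite_induct) (simp_all add: S_0 S_add)
  have const_sum: "fps_const (\<Sum>x\<in>A. f x) = (\<Sum>x\<in>A. fps_const (f x))"
    for f :: "nat \<Rightarrow> complex mvps" and A :: "nat set"
    by (induction A rule: infinite_finite_induct) (simp_all flip: fps_const_add)
  have w: "?w = ec2.fexp ?h"
    unfolding xi_fexp
    by (rule fexp_hom[OF exp_coeffs_exp_coeff ec2.exp_coeffs_axioms])
       (auto intro!: fps_ext simp: fps_mult_nth const_sum eta_series_0 simp flip: fps_const_add fps_const_mult)
  have W: "?W = ec2.fexp (fps_map S (eta_series v))"
    unfolding xi_fexp
    by (rule fexp_hom[OF exp_coeffs_exp_coeff ec2.exp_coeffs_axioms])
       (auto intro!: fps_ext simp: fps_mult_nth S_sum S_add S_mult S_0 S_1 S_mconst exp_coeff_def eta_series_0)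
  have S_eta: "fps_map S (eta_series v) = ?h + fay_H 0 (-1) v"
  proof (rule fps_ext, rule fps_ext)
    fix j i
    show "fps_map S (eta_series v) $ j $ i = (?h + fay_H 0 (-1) v) $ j $ i"
      by (cases "i = 0"; cases "j = 0")
         (simp_all add: S_def eta_series_def fay_H_nth shift_scalar_0 eta_shift shift_uminus)
  qed
  have h0: "?h $ 0 = 0" by (simp add: eta_series_0)
  have "?W = ?w * ec2.fexp (fay_H 0 (-1) v)"
    unfolding W S_eta w by (rule ec2.fexp_add[OF h0]) simp
  then have "fay 0 (-1) v \<longleftrightarrow> ?W = ?w * (1 + fay_X 0 (-1) v)"
    unfolding fay_def using ec2.fexp_mult_cancel[OF h0] w by metis
  also have "\<dots> \<longleftrightarrow> (\<forall>j i. ?W $ j $ i = (?w * (1 + fay_X 0 (-1) v)) $ j $ i)"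
    by (simp only: fps_eq_iff)
  also have "\<dots> \<longleftrightarrow> (\<forall>j i. i \<ge> 1 \<longrightarrow> shift (-1) i (xi v j)
     = (\<Sum>b<j. xi v b * pd 1 (shift (-1) (i + j - 1 - b) v)))"
  proof (intro arg_cong[of _ _ All] ext)
    fix j i
    \<comment> \<open>The shift with scalar 0 is trivial, so only \<open>p = 0\<close> remains in
      the quotient.\<close>
    have X: "fay_X 0 (-1) v $ q $ i = (if i = 0 \<or> q = 0 then 0 else pd 1 (shift (-1) (i + q - 1) v))" for q
    proof (cases "i = 0 \<or> q = 0")
      case True
      then show ?thesis using fay_Q_sum_0[of 0 "-1" v i] by (auto simp: fay_X_nth)
    next
      case False
      then have "(\<Sum>p<i. fay_Q 0 (-1) v p (i + q - 1 - p)) = (\<Sum>p\<in>{0}. fay_Q 0 (-1) v p (i + q - 1 - p))"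
        by (intro sum.mono_neutral_right) (auto simp: fay_Q_def shift_scalar_0)
      with False show ?thesis by (simp add: fay_X_nth fay_Q_def shift_scalar_0 pd_shift)
    qed
    have "(?w * (1 + fay_X 0 (-1) v)) $ j $ i = ?w $ j $ i + (\<Sum>b=0..j. xi v b * fay_X 0 (-1) v $ (j - b) $ i)"
      by (simp add: distrib_left fps_mult_nth[of _ "fay_X _ _ _"] fps_sum_nth)
    also have "(\<Sum>b=0..j. xi v b * fay_X 0 (-1) v $ (j - b) $ i)
        = (if i = 0 then 0 else \<Sum>b<j. xi v b * pd 1 (shift (-1) (i + j - 1 - b) v))"
    proof (cases "i = 0")
      case False
      have "(\<Sum>b=0..j. xi v b * fay_X 0 (-1) v $ (j - b) $ i)
          = (\<Sum>b<j. xi v b * pd 1 (shift (-1) (i + j - 1 - b) v))"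
        by (rule sum.mono_neutral_cong_right) (use False in \<open>auto simp: X\<close>)
      with False show ?thesis by simp
    qed (simp add: fay_X_nth)
    finally show "(?W $ j $ i = (?w * (1 + fay_X 0 (-1) v)) $ j $ i) = (i \<ge> 1 \<longrightarrow> shift (-1) i (xi v j)
        = (\<Sum>b<j. xi v b * pd 1 (shift (-1) (i + j - 1 - b) v)))"
      by (simp add: S_def)
  qed
  finally show ?thesis by blast
qed

text \<open>The convolution formula is \<open>shift_eqs\<close> iterated down to the constant
  \<open>xi v 0\<close>, each step raising the shift index by one; conversely, two consecutive
  convolutions differ by one term.\<close>

theorem KP_solution_iff_fay: "KP_solution v \<longleftrightarrow> fay (1/2) (-1/2) v"
  unfolding KP_solution_iff_shift_eqs fay_0_iff[symmetric] fay_iff_convolution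
proof
  assume eqs: "shift_eqs v"
  show "\<forall>i\<ge>1. \<forall>j. shift (-1) i (xi v j) = (\<Sum>b<j. xi v b * pd 1 (shift (-1) (i + j - 1 - b) v))"
  proof (intro allI impI)
    fix i j :: nat assume "i \<ge> 1"
    then show "shift (-1) i (xi v j) = (\<Sum>b<j. xi v b * pd 1 (shift (-1) (i + j - 1 - b) v))"
    proof (induction j arbitrary: i)
      case (Suc j)
      have "shift (-1) i (xi v (Suc j)) = shift (-1) (Suc i) (xi v j) + pd 1 (shift (-1) i v) * xi v j"
        using eqs Suc.prems by (simp add: shift_eqs_def)
      then show ?case using Suc.IH[of "Suc i"] by (simp add: mult.commute)
    qed (simp add: shift_xi_0)
  qed
next
  assume conv: "\<forall>i\<ge>1. \<forall>j. shift (-1) i (xi v j) = (\<Sum>b<j. xi v b * pd 1 (shift (-1) (i + j - 1 - b) v))"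
  show "shift_eqs v"
    unfolding shift_eqs_def
  proof (intro allI impI)
    fix r j :: nat assume "r \<ge> 1"
    then show "shift (-1) r (xi v (Suc j)) = shift (-1) (Suc r) (xi v j) + pd 1 (shift (-1) r v) * xi v j"
      using conv[rule_format, of r "Suc j"] conv[rule_format, of "Suc r" j] by (simp add: mult.commute)
  qed
qed

text \<open>The \<open>xi\<close>, the \<open>eta\<close> and the \<open>\<partial>_m v\<close>
  determine each other triangularly, through the Euler recursions of the exponential and of the
  shift.\<close>

lemma pd_xi_eq_0_iff: "(\<forall>i\<ge>1. pd n (xi v i) = 0) \<longleftrightarrow> (\<forall>m\<ge>1. pd n (pd m v) = 0)"
proof -
  have pd_of_nat: "pd n (of_nat c * f) = of_nat c * pd n f" for c and f :: "complex mvps"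
    by (simp only: mconst_of_nat[symmetric] pd_mconst_mult)
  have pd_1: "pd n (xi v 0) = 0" by (simp add: xi_0)
  have "(\<forall>i\<ge>1. pd n (xi v i) = 0) \<longleftrightarrow> (\<forall>r\<ge>1. pd n (eta v r) = 0)"
  proof (intro iffI allI impI)
    fix r :: nat
    assume xi: "\<forall>i\<ge>1. pd n (xi v i) = 0" and "r \<ge> 1"
    then have xi': "pd n (xi v i) = 0" for i using pd_1 by (cases i) auto
    from \<open>r \<ge> 1\<close> show "pd n (eta v r) = 0"
    proof (induction r rule: less_induct)
      case (less r)
      then obtain j where r: "r = Suc j" by (cases r) auto
      have "0 = pd n (of_nat (Suc j) * xi v (Suc j))" by (simp only: pd_of_nat xi' mult_zero_right)
      also have "\<dots> = (\<Sum>i=0..j. xi v i * (of_nat (Suc (j - i)) * pd n (eta v (Suc (j - i)))))"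
        unfolding xi_euler pd_sum pd_mult[of n "xi v _"] xi' pd_of_nat by simp
      \<comment> \<open>For \<open>i > 0\<close> only \<open>eta\<close> of smaller index occurs;
        \<open>i = 0\<close> leaves the new one with factor \<open>xi v 0 = 1\<close>.\<close>
      also have "\<dots> = (\<Sum>i\<in>{0}. xi v i * (of_nat (Suc (j - i)) * pd n (eta v (Suc (j - i)))))"
        by (rule sum.mono_neutral_right) (auto simp: less r simp del: of_nat_Suc)
      finally have "of_nat (Suc j) * pd n (eta v (Suc j)) = 0" by (simp add: xi_0 of_nat_Suc[of 0] del: of_nat_Suc)
      then show ?case unfolding r by (rule of_nat_Suc_mult_eq_0)
    qed
  next
    fix i :: nat
    assume eta: "\<forall>r\<ge>1. pd n (eta v r) = 0" and "i \<ge> 1"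
    show "pd n (xi v i) = 0"
    proof (induction i rule: less_induct)
      case (less i)
      show ?case
      proof (cases i)
        case (Suc j)
        have "of_nat (Suc j) * pd n (xi v (Suc j)) = pd n (of_nat (Suc j) * xi v (Suc j))"
          by (simp only: pd_of_nat)
        also have "\<dots> = 0"
          unfolding xi_euler pd_sum pd_mult[of n "xi v _"] pd_of_nat
          by (simp add: less Suc eta)
        finally show ?thesis unfolding Suc by (rule of_nat_Suc_mult_eq_0)
      qed (simp add: pd_1)
    qed
  qed
  also have "\<dots> \<longleftrightarrow> (\<forall>r\<ge>1. pd n (shift (-1) r v) = 0)"
    by (simp add: eta_shift pd_uminus)
  also have "\<dots> \<longleftrightarrow> (\<forall>m\<ge>1. pd n (pd m v) = 0)"
  proof -
    have rec: "of_nat r * pd n (shift (-1) r v) = - (\<Sum>i=1..r. pd i (pd n (shift (-1) (r - i) v)))" for r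
      unfolding pd_of_nat[symmetric] shift_rec by (simp add: mconst_uminus pd_uminus pd_sum pd_commute[of n])
    show ?thesis
    proof (intro iffI allI impI)
      fix r :: nat
      assume m: "\<forall>m\<ge>1. pd n (pd m v) = 0" and "r \<ge> 1"
      from \<open>r \<ge> 1\<close> show "pd n (shift (-1) r v) = 0"
      proof (induction r rule: less_induct)
        case (less r)
        have "pd i (pd n (shift (-1) (r - i) v)) = 0" if "i \<in> {1..r}" for i
        proof (cases "i = r")
          case True
          then show ?thesis using m that by (simp add: pd_commute[of r n])
        next
          case False
          then have "r - i < r" "r - i \<ge> 1" using that by auto
          then show ?thesis using less.IH[of "r - i"] by simp
        qed
        then have "of_nat r * pd n (shift (-1) r v) = of_nat r * 0"
          unfolding rec by (simp add: sum.neutral)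
        then show ?case using less.prems of_nat_mult_cancel[of r _ 0] by simp
      qed
    next
      fix m :: nat
      assume s: "\<forall>r\<ge>1. pd n (shift (-1) r v) = 0" and m: "m \<ge> 1"
      have "0 = (\<Sum>i=1..m. pd i (pd n (shift (-1) (m - i) v)))"
        using rec[of m] s m by simp
      \<comment> \<open>For \<open>i = m\<close> the shift has index 0 and is \<open>v\<close>
        itself; all others have positive index.\<close>
      also have "\<dots> = (\<Sum>i\<in>{m}. pd i (pd n (shift (-1) (m - i) v)))"
      proof (rule sum.mono_neutral_right)
        show "\<forall>i\<in>{1..m} - {m}. pd i (pd n (shift (-1) (m - i) v)) = 0"
        proof
          fix i assume "i \<in> {1..m} - {m}"
          then have "m - i \<ge> 1" by auto
          with s show "pd i (pd n (shift (-1) (m - i) v)) = 0" by simp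
        qed
      qed (use m in auto)
      finally show "pd n (pd m v) = 0" by (simp add: pd_commute[of n])
    qed
  qed
  finally show ?thesis .
qed

theorem GD_solution_iff_fay:
  "GD_solution n v \<longleftrightarrow> fay (1/2) (-1/2) v \<and> (\<forall>m\<ge>1. pd n (pd m v) = 0)"
  by (simp only: GD_solution_def KP_solution_iff_fay pd_xi_eq_0_iff)

section \<open>Differential polynomials with rational coefficients\<close>

abbreviation qconst :: "rat \<Rightarrow> complex mvps" where
  "qconst q \<equiv> mconst (of_rat q)"

lemma qconst_mult: "qconst (p * q) = qconst p * qconst q"
  by (simp add: of_rat_mult mconst_mult)

text \<open>The span is taken among maps of \<open>v\<close>, so that the rational constants are
  chosen independently of \<open>v\<close>.\<close>

inductive_set qspan :: "(complex mvps \<Rightarrow> complex mvps) set \<Rightarrow> (complex mvps \<Rightarrow> complex mvps) set"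
  for B where
  zero: "(\<lambda>v. 0) \<in> qspan B"
| step: "b \<in> B \<Longrightarrow> F \<in> qspan B \<Longrightarrow> (\<lambda>v. qconst q * b v + F v) \<in> qspan B"

lemma qspan_add: "F \<in> qspan B \<Longrightarrow> G \<in> qspan B \<Longrightarrow> (\<lambda>v. F v + G v) \<in> qspan B"
  by (induction rule: qspan.induct) (simp_all add: add.assoc qspan.step)

lemma qspan_base: "b \<in> B \<Longrightarrow> b \<in> qspan B"
  using qspan.step[OF _ qspan.zero, of b B 1] by simp

lemma qspan_induct [consumes 1, case_names base zero add scale]:
  assumes "F \<in> qspan B"
    and "\<And>b. b \<in> B \<Longrightarrow> P b" "P (\<lambda>v. 0)"
    and "\<And>F G. P F \<Longrightarrow> P G \<Longrightarrow> P (\<lambda>v. F v + G v)"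
    and "\<And>q F. P F \<Longrightarrow> P (\<lambda>v. qconst q * F v)"
  shows "P F"
  using assms(1)
proof (induction rule: qspan.induct)
  case (step b F q)
  show ?case by (rule assms(4)[OF assms(5)[OF assms(2)[OF step(1)]] step(3)])
qed (rule assms(3))

lemma qspan_scale: "F \<in> qspan B \<Longrightarrow> (\<lambda>v. qconst q * F v) \<in> qspan B"
proof (induction rule: qspan.induct)
  case (step b F p)
  then show ?case
    using qspan.step[of b B "\<lambda>v. qconst q * F v" "q * p"]
    by (simp add: distrib_left qconst_mult mult.assoc)
qed (simp add: qspan.zero)

lemma qspan_mono: "B \<subseteq> D \<Longrightarrow> F \<in> qspan B \<Longrightarrow> F \<in> qspan D"
  by (rotate_tac, induction rule: qspan.induct) (auto intro: qspan.intros)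

lemma qspan_image_sum:
  assumes "F \<in> qspan (g ` A)" "finite A"
  shows "\<exists>N. \<forall>v. F v = (\<Sum>a\<in>A. qconst (N a) * g a v)"
  using assms(1)
proof (induction rule: qspan.induct)
  case zero
  show ?case by (rule exI[of _ "\<lambda>_. 0"]) simp
next
  case (step b F q)
  then obtain N a where N: "\<forall>v. F v = (\<Sum>a\<in>A. qconst (N a) * g a v)" and a: "a \<in> A" "b = g a"
    by blast
  have "(\<Sum>x\<in>A. qconst ((if x = a then q else 0) + N x) * g x v) = qconst q * b v + F v" for v
  proof -
    have "(\<Sum>x\<in>A. qconst (if x = a then q else 0) * g x v) = (\<Sum>x\<in>{a}. qconst q * g x v)"
      by (rule sum.mono_neutral_cong_right) (use assms(2) a in auto)
    with N a show ?thesis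
      by (simp add: of_rat_add mconst_add distrib_right sum.distrib)
  qed
  then show ?case by (intro exI[of _ "\<lambda>x. (if x = a then q else 0) + N x"]) simp
qed

section \<open>Differential polynomials graded by weight and excess\<close>

definition jet_mono :: "(nat \<times> nat) list \<Rightarrow> complex mvps \<Rightarrow> complex mvps" where
  "jet_mono M v = (\<Prod>(s, t)\<leftarrow>M. pd s ((pd 1 ^^ t) v))"

lemma jet_mono_simps [simp]:
  "jet_mono [] v = 1"
  "jet_mono ((s, t) # M) v = pd s ((pd 1 ^^ t) v) * jet_mono M v"
  "jet_mono (M @ M') v = jet_mono M v * jet_mono M' v"
  by (simp_all add: jet_mono_def)

text \<open>
  The inequality in \<open>gd_matrices\<close> says that the excess \<open>\<Sum> (t\<^sub>j - 1)\<close> is at least \<open>k - 2\<close>, and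
  the parity condition that it is congruent to \<open>k\<close>.  In this form both are compatible with
  products (excesses add up) and with derivations (which raise the bound by one).
\<close>

definition excess :: "(nat \<times> nat) list \<Rightarrow> nat" where
  "excess M = (\<Sum>(s, t)\<leftarrow>M. t - 1)"

definition jet_matrices :: "nat \<Rightarrow> nat \<Rightarrow> nat \<Rightarrow> (nat \<times> nat) list set" where
  "jet_matrices n w e = {M. M \<noteq> [] \<and> (\<forall>(s, t) \<in> set M. 1 \<le> s \<and> s < n \<and> 1 \<le> t) \<and>
     w = (\<Sum>(s, t)\<leftarrow>M. s + t) \<and> e \<le> excess M \<and> even (e + excess M)}"

lemma gd_matrices_eq:
  assumes "length is \<ge> 2"
  shows "gd_matrices n is = jet_matrices n (sum_list is) (length is - 2)"
proof -
  have t: "(\<Sum>(s, t)\<leftarrow>M. t) = excess M + length M" if "\<forall>(s, t) \<in> set M. 1 \<le> s \<and> s < n \<and> 1 \<le> t" for M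
    using that by (induction M) (auto simp: excess_def)
  have par: "even (length is + length M + (excess M + length M)) = even (length is - 2 + excess M)" for M
    using assms by (auto simp: even_diff_nat)
  show ?thesis
    unfolding gd_matrices_def jet_matrices_def
    using t par assms by (intro Collect_cong) (auto simp: t)
qed

text \<open>
  \<open>jet_polys n V w e\<close> consists of the maps that agree on \<open>V\<close> with a rational differential
  polynomial in the \<open>\<partial>\<^sub>s \<partial>\<^sup>t v\<close> of weight \<open>w\<close> and excess at least \<open>e\<close>.
\<close>

definition jet_polys :: "nat \<Rightarrow> complex mvps set \<Rightarrow> nat \<Rightarrow> nat \<Rightarrow> (complex mvps \<Rightarrow> complex mvps) set" where
  "jet_polys n V w e = {F. \<exists>r \<in> qspan (jet_mono ` jet_matrices n w e). \<forall>v\<in>V. F v = r v}"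

lemma jet_polysI: "F \<in> qspan (jet_mono ` jet_matrices n w e) \<Longrightarrow> F \<in> jet_polys n V w e"
  by (auto simp: jet_polys_def)

lemma jet_polys_base: "M \<in> jet_matrices n w e \<Longrightarrow> jet_mono M \<in> jet_polys n V w e"
  by (intro jet_polysI qspan_base imageI)

lemma jet_polys_zero: "(\<lambda>v. 0) \<in> jet_polys n V w e"
  by (intro jet_polysI qspan.zero)

lemma jet_polys_add:
  "F \<in> jet_polys n V w e \<Longrightarrow> G \<in> jet_polys n V w e \<Longrightarrow> (\<lambda>v. F v + G v) \<in> jet_polys n V w e"
  unfolding jet_polys_def using qspan_add by fastforce

lemma jet_polys_scale: "F \<in> jet_polys n V w e \<Longrightarrow> (\<lambda>v. qconst q * F v) \<in> jet_polys n V w e"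
  unfolding jet_polys_def using qspan_scale by fastforce

lemma jet_polys_uminus: "F \<in> jet_polys n V w e \<Longrightarrow> (\<lambda>v. - F v) \<in> jet_polys n V w e"
  using jet_polys_scale[of F n V w e "- 1"] by (simp add: of_rat_minus mconst_uminus)

lemma jet_polys_diff:
  "F \<in> jet_polys n V w e \<Longrightarrow> G \<in> jet_polys n V w e \<Longrightarrow> (\<lambda>v. F v - G v) \<in> jet_polys n V w e"
  using jet_polys_add[OF _ jet_polys_uminus, of F n V w e G] by simp

lemma jet_polys_sum:
  "(\<And>x. x \<in> A \<Longrightarrow> F x \<in> jet_polys n V w e) \<Longrightarrow> (\<lambda>v. \<Sum>x\<in>A. F x v) \<in> jet_polys n V w e"
  by (induction A rule: infinite_finite_induct) (simp_all add: jet_polys_zero jet_polys_add)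

lemma jet_polys_mono:
  assumes "F \<in> jet_polys n V w e" "e' \<le> e" "even (e + e')"
  shows "F \<in> jet_polys n V w e'"
proof -
  have "jet_matrices n w e \<subseteq> jet_matrices n w e'"
    using assms(2,3) by (auto simp: jet_matrices_def)
  then have "qspan (jet_mono ` jet_matrices n w e) \<subseteq> qspan (jet_mono ` jet_matrices n w e')"
    using qspan_mono[OF image_mono] by blast
  with assms(1) show ?thesis unfolding jet_polys_def by blast
qed

lemma jet_polys_cong: "F \<in> jet_polys n V w e \<Longrightarrow> (\<And>v. v \<in> V \<Longrightarrow> G v = F v) \<Longrightarrow> G \<in> jet_polys n V w e"
  unfolding jet_polys_def by fastforce

lemma jet_polys_induct [consumes 1, case_names base zero add scale cong]:
  assumes "F \<in> jet_polys n V w e"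
    and "\<And>M. M \<in> jet_matrices n w e \<Longrightarrow> P (jet_mono M)" "P (\<lambda>v. 0)"
    and "\<And>F G. P F \<Longrightarrow> P G \<Longrightarrow> P (\<lambda>v. F v + G v)"
    and "\<And>q F. P F \<Longrightarrow> P (\<lambda>v. qconst q * F v)"
    and cong: "\<And>F G. P F \<Longrightarrow> (\<And>v. v \<in> V \<Longrightarrow> G v = F v) \<Longrightarrow> P G"
  shows "P F"
proof -
  obtain r where r: "r \<in> qspan (jet_mono ` jet_matrices n w e)" "\<forall>v\<in>V. F v = r v"
    using assms(1) unfolding jet_polys_def by blast
  from r(1) have "P r" by (induction rule: qspan_induct) (auto intro: assms(2-5))
  with r(2) cong show ?thesis by blast
qed

lemma jet_polys_mult:
  assumes "F \<in> jet_polys n V w e" "G \<in> jet_polys n V w' e'"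
  shows "(\<lambda>v. F v * G v) \<in> jet_polys n V (w + w') (e + e')"
  using assms(1)
proof (induction rule: jet_polys_induct)
  case (base M)
  show ?case
    using assms(2)
  proof (induction rule: jet_polys_induct)
    case (base M')
    have "M @ M' \<in> jet_matrices n (w + w') (e + e')"
      using \<open>M \<in> _\<close> base by (auto simp: jet_matrices_def excess_def)
    then have "jet_mono (M @ M') \<in> jet_polys n V (w + w') (e + e')" by (rule jet_polys_base)
    then show ?case by (simp add: jet_mono_simps(3)[abs_def])
  next
    case (add F' G')
    then show ?case using jet_polys_add by (simp add: distrib_left)
  next
    case (scale q F')
    then show ?case using jet_polys_scale[of "\<lambda>v. jet_mono M v * F' v"] by (simp add: mult.left_commute)
  next
    case (cong F' G')
    then show ?case by (auto intro: jet_polys_cong)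
  qed (simp add: jet_polys_zero)
next
  case (add F' G')
  then show ?case using jet_polys_add by (simp add: distrib_right)
next
  case (scale q F')
  then show ?case using jet_polys_scale[of "\<lambda>v. F' v * G v"] by (simp add: mult.assoc)
next
  case (cong F' G')
  then show ?case by (auto intro: jet_polys_cong)
qed (simp add: jet_polys_zero)

text \<open>By the product rule, one factor is differentiated at a time and its excess rises from
  \<open>t - 1\<close> to \<open>t\<close>. The bound \<open>s + t \<le> w\<close> ensures in the
  recursion that only derivatives \<open>\<partial>_c \<partial>_s v\<close> of lower weight are
  consulted.\<close>

lemma jet_polys_pd:
  assumes "F \<in> jet_polys n V w e"
    and "\<And>s t. 1 \<le> s \<Longrightarrow> s < n \<Longrightarrow> 1 \<le> t \<Longrightarrow> s + t \<le> w \<Longrightarrow>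
      (\<lambda>v. pd c (pd s ((pd 1 ^^ t) v))) \<in> jet_polys n V (c + s + t) t"
  shows "(\<lambda>v. pd c (F v)) \<in> jet_polys n V (c + w) (e + 1)"
  using assms(1)
proof (induction rule: jet_polys_induct)
  case (base M)
  have gen: "(\<lambda>v. pd c (jet_mono M v)) \<in> jet_polys n V (c + (\<Sum>(s, t)\<leftarrow>M. s + t)) (excess M + 1)"
    if "M \<noteq> []" "\<forall>(s, t)\<in>set M. 1 \<le> s \<and> s < n \<and> 1 \<le> t \<and> s + t \<le> w" for M
    using that
  proof (induction M rule: list_nonempty_induct)
    case (single x)
    then show ?case using assms(2) by (cases x) (auto simp: excess_def simp flip: add.assoc)
  next
    case (cons x M)
    obtain s t where x: "x = (s, t)" by (cases x)
    let ?w = "\<Sum>(s, t)\<leftarrow>M. s + t"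
    have st: "1 \<le> s" "s < n" "1 \<le> t" "s + t \<le> w" using cons.prems x by auto
    have "jet_mono [(s, t)] \<in> jet_polys n V (s + t) (t - 1)"
      by (rule jet_polys_base) (use st in \<open>auto simp: jet_matrices_def excess_def\<close>)
    moreover have "jet_mono M \<in> jet_polys n V ?w (excess M)"
      by (rule jet_polys_base) (use cons in \<open>auto simp: jet_matrices_def\<close>)
    moreover have "(\<lambda>v. pd c (jet_mono [(s, t)] v)) \<in> jet_polys n V (c + s + t) t"
      using assms(2)[OF st] by simp
    moreover have "(\<lambda>v. pd c (jet_mono M v)) \<in> jet_polys n V (c + ?w) (excess M + 1)"
      using cons by simp
    ultimately have "(\<lambda>v. pd c (jet_mono [(s, t)] v) * jet_mono M v + jet_mono [(s, t)] v * pd c (jet_mono M v))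
        \<in> jet_polys n V (c + (s + t + ?w)) (t + excess M)"
      using jet_polys_mult[of "\<lambda>v. pd c (jet_mono [(s, t)] v)" n V "c + s + t" t "jet_mono M" ?w "excess M"]
        jet_polys_mult[of "jet_mono [(s, t)]" n V "s + t" "t - 1" "\<lambda>v. pd c (jet_mono M v)" "c + ?w" "excess M + 1"] st
      by (intro jet_polys_add) (simp_all add: ac_simps)
    then show ?case using st by (simp add: x pd_mult excess_def)
  qed
  have "\<forall>(s, t)\<in>set M. s + t \<le> w"
  proof clarify
    fix s t assume "(s, t) \<in> set M"
    then have "s + t \<in> set (map (\<lambda>(s, t). s + t) M)" by force
    then have "s + t \<le> sum_list (map (\<lambda>(s, t). s + t) M)" by (rule member_le_sum_list) simp
    with base show "s + t \<le> w" by (simp add: jet_matrices_def)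
  qed
  then have "(\<lambda>v. pd c (jet_mono M v)) \<in> jet_polys n V (c + w) (excess M + 1)"
    using gen[of M] base by (auto simp: jet_matrices_def)
  then show ?case
    by (rule jet_polys_mono) (use base in \<open>auto simp: jet_matrices_def\<close>)
next
  case (add F G)
  then show ?case using jet_polys_add by (simp add: pd_add)
next
  case (scale q F)
  then show ?case using jet_polys_scale[of "\<lambda>v. pd c (F v)"] by (simp add: pd_mconst_mult)
next
  case (cong F G)
  then show ?case by (elim jet_polys_cong) simp
qed (simp add: jet_polys_zero)

lemma pd_funpow_commute: "pd i ((pd j ^^ t) f) = (pd j ^^ t) (pd i f)"
  by (induction t) (simp_all add: pd_commute[of i])

text \<open>Each application of \<open>\<partial>\<close> turns a factor
  \<open>\<partial>_s \<partial>^t v\<close> into \<open>\<partial>_s \<partial>^(t+1) v\<close>,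
  again an admissible one.\<close>

lemma jet_polys_pd_1:
  assumes "F \<in> jet_polys n V w e"
  shows "(\<lambda>v. (pd 1 ^^ t) (F v)) \<in> jet_polys n V (w + t) (e + t)"
proof (induction t)
  case (Suc t)
  have "(\<lambda>v. pd 1 ((pd 1 ^^ t) (F v))) \<in> jet_polys n V (1 + (w + t)) (e + t + 1)"
    using Suc
  proof (rule jet_polys_pd)
    fix s t :: nat assume st: "1 \<le> s" "s < n" "1 \<le> t"
    have "jet_mono [(s, Suc t)] \<in> jet_polys n V (1 + s + t) t"
      by (rule jet_polys_base) (use st in \<open>auto simp: jet_matrices_def excess_def\<close>)
    then show "(\<lambda>v. pd 1 (pd s ((pd 1 ^^ t) v))) \<in> jet_polys n V (1 + s + t) t"
      by (simp add: jet_mono_simps[abs_def] jet_mono_def[abs_def] pd_commute[of s "Suc 0"])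
  qed
  then show ?case by simp
qed (use assms in simp)

section \<open>Homogeneous linear expressions in the derivatives of v\<close>

lemma qspan_sum: "(\<And>x. x \<in> A \<Longrightarrow> F x \<in> qspan B) \<Longrightarrow> (\<lambda>v. \<Sum>x\<in>A. F x v) \<in> qspan B"
  by (induction A rule: infinite_finite_induct) (simp_all add: qspan.zero qspan_add)

definition jets :: "nat \<Rightarrow> nat \<Rightarrow> (complex mvps \<Rightarrow> complex mvps) set" where
  "jets k w = qspan (pds ` {is. length is = k \<and> (\<forall>i\<in>set is. i \<ge> 1) \<and> sum_list is = w})"

lemma jets_id: "(\<lambda>v. v) \<in> jets 0 0"
proof -
  have "pds [] \<in> jets 0 0" unfolding jets_def by (intro qspan_base imageI) simp
  then show ?thesis by (simp add: pds_Nil[abs_def])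
qed

lemma jets_pd:
  assumes "F \<in> jets k w" "i \<ge> 1"
  shows "(\<lambda>v. pd i (F v)) \<in> jets (Suc k) (i + w)"
  using assms(1) unfolding jets_def
proof (induction rule: qspan_induct)
  case (base b)
  then obtain I where I: "b = pds I" "length I = k" "\<forall>i\<in>set I. i \<ge> 1" "sum_list I = w" by blast
  then have "pds (i # I) \<in> qspan (pds ` {is. length is = Suc k \<and> (\<forall>i\<in>set is. i \<ge> 1) \<and> sum_list is = i + w})"
    using assms(2) by (intro qspan_base imageI) auto
  then show ?case by (simp add: I pds_Cons[abs_def])
qed (simp_all add: qspan.zero pd_add qspan_add pd_mconst_mult qspan_scale)

lemma jets_cpow: "F \<in> jets k w \<Longrightarrow> (\<lambda>v. cpow l r (F v)) \<in> jets (l + k) (r + w)"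
proof (induction l arbitrary: r)
  case 0
  then show ?case by (cases "r = 0") (simp_all add: jets_def qspan.zero)
next
  case (Suc l)
  have "(\<lambda>v. \<Sum>i=1..r. qconst (1 / of_nat i) * pd i (cpow l (r - i) (F v))) \<in> jets (Suc l + k) (r + w)"
    unfolding jets_def
  proof (intro qspan_sum qspan_scale)
    fix i assume i: "i \<in> {1..r}"
    then have "i + (r - i + w) = r + w" by simp
    with jets_pd[OF Suc.IH[OF Suc.prems, of "r - i"], of i] i
    show "(\<lambda>v. pd i (cpow l (r - i) (F v)))
        \<in> qspan (pds ` {is. length is = Suc l + k \<and> (\<forall>i\<in>set is. i \<ge> 1) \<and> sum_list is = r + w})"
      by (simp add: jets_def)
  qed
  then show ?case by (simp add: of_rat_divide)
qed

definition valid_index :: "nat list \<Rightarrow> bool" where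
  "valid_index is \<longleftrightarrow> length is \<ge> 2 \<and> (\<forall>i\<in>set is. i \<ge> 1)"

text \<open>The induction hypothesis at a pair of weight \<open>w\<close>: in the order of reduction
  these indices precede every such pair.\<close>

definition reducible :: "nat \<Rightarrow> complex mvps set \<Rightarrow> nat \<Rightarrow> bool" where
  "reducible n V w \<longleftrightarrow> (\<forall>is. valid_index is \<and> (sum_list is < w \<or> sum_list is = w \<and> length is \<ge> 3) \<longrightarrow>
     pds is \<in> jet_polys n V (sum_list is) (length is - 2))"

text \<open>For even \<open>k\<close> the excess bound \<open>k - 2\<close> may be lowered to 0
  without violating parity.\<close>

lemma jets_jet_polys:
  assumes "reducible n V w" "F \<in> jets k u" "even k" "u < w \<and> k \<ge> 2 \<or> u = w \<and> k \<ge> 4"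
  shows "F \<in> jet_polys n V u 0"
  using assms(2) unfolding jets_def
proof (induction rule: qspan_induct)
  case (base b)
  then obtain I where I: "b = pds I" "length I = k" "\<forall>i\<in>set I. i \<ge> 1" "sum_list I = u" by blast
  then have "b \<in> jet_polys n V u (k - 2)"
    using assms(1,4) by (auto simp: reducible_def valid_index_def)
  then show ?case
    by (rule jet_polys_mono) (use assms(3,4) in \<open>auto simp: even_diff_nat\<close>)
qed (simp_all add: jet_polys_zero jet_polys_add jet_polys_scale)

section \<open>Coefficients of the symmetric Fay identity\<close>

lemma of_rat_fact: "of_rat (fact l) = (fact l :: 'a :: field_char_0)"
  by (metis of_nat_fact of_rat_of_nat_eq)

lemma exp_coeff_qconst: "exp_coeff l = qconst (1 / fact l)"
  by (simp add: exp_coeff_def of_rat_divide of_rat_fact)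

lemma mconst_diff: "mconst (a - b) = mconst a - mconst (b :: 'a :: comm_ring_1)"
  using mconst_add[of a "- b"] by (simp add: mconst_uminus)

text \<open>The Taylor coefficients of \<open>exp (A/2) - exp (-A/2)\<close>, an odd
  function.\<close>

definition H_coeff :: "nat \<Rightarrow> rat" where
  "H_coeff l = ((1/2) ^ l - (-1/2) ^ l) / fact l"

text \<open>The coefficients of \<open>A^l B^m\<close> in
  \<open>exp ((A - B)/2) - exp ((B - A)/2)\<close>, which is odd in the total degree.\<close>

definition Q_coeff :: "nat \<Rightarrow> nat \<Rightarrow> rat" where
  "Q_coeff l m = ((1/2) ^ l * (-1/2) ^ m - (-1/2) ^ l * (1/2) ^ m) / (fact l * fact m)"

lemma of_rat_H_coeff: "of_rat (H_coeff l) = (1/2) ^ l / fact l - (-1/2) ^ l / (fact l :: complex)"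
  by (simp add: H_coeff_def of_rat_divide of_rat_diff of_rat_power of_rat_minus of_rat_fact diff_divide_distrib)

lemma of_rat_Q_coeff:
  "of_rat (Q_coeff l m) = (1/2) ^ l * (-1/2) ^ m / (fact l * fact m)
     - (-1/2) ^ l * (1/2) ^ m / (fact l * fact m :: complex)"
  by (simp add: Q_coeff_def of_rat_divide of_rat_diff of_rat_mult of_rat_power of_rat_minus of_rat_fact
      diff_divide_distrib)

lemma H_coeff_1: "H_coeff (Suc 0) = 1"
  by (simp add: H_coeff_def)

lemma H_coeff_even: "even l \<Longrightarrow> H_coeff l = 0"
  by (simp add: H_coeff_def power_minus_even)

lemma Q_coeff_0_1: "Q_coeff 0 (Suc 0) = - 1"
  by (simp add: Q_coeff_def)

lemma Q_coeff_even:
  assumes "even (l + m)"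
  shows "Q_coeff l m = 0"
proof -
  have "(1/2) ^ l * (-1/2) ^ m = ((-1/2) ^ l * (1/2) ^ m :: rat)"
  proof (cases "even l")
    case True
    with assms show ?thesis by (simp add: power_minus_even)
  next
    case False
    with assms show ?thesis by (simp add: power_minus_odd)
  qed
  then show ?thesis by (simp add: Q_coeff_def)
qed

lemma fay_H_expansion:
  "fay_H (1/2) (-1/2) v $ j $ i = - (\<Sum>(l, m)\<in>{0..i} \<times> {0..j}.
     qconst (H_coeff l * H_coeff m) * cpow l i (cpow m j v))"
proof -
  have S: "shift (1/2) r f - shift (-1/2) r f = (\<Sum>l=0..r. qconst (H_coeff l) * cpow l r f)" for r f
    unfolding shift_def sum_subtractf[symmetric] left_diff_distrib[symmetric]
    by (simp only: of_rat_H_coeff mconst_diff)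
  have cpow_sum: "cpow l i (\<Sum>x\<in>A. f x) = (\<Sum>x\<in>A. cpow l i (f x))" for l f and A :: "nat set"
    by (induction A rule: infinite_finite_induct) (simp_all add: cpow_add)
  have "fay_H (1/2) (-1/2) v $ j $ i
      = - (shift (1/2) i (shift (1/2) j v - shift (-1/2) j v)
           - shift (-1/2) i (shift (1/2) j v - shift (-1/2) j v))"
    by (simp add: fay_H_nth shift_diff)
  also have "\<dots> = - (\<Sum>l=0..i. \<Sum>m=0..j. qconst (H_coeff l * H_coeff m) * cpow l i (cpow m j v))"
    unfolding S by (simp add: cpow_sum cpow_mconst_mult sum_distrib_left qconst_mult mult.assoc)
  finally show ?thesis by (simp add: sum.cartesian_product)
qed

text \<open>Only odd \<open>l\<close> and \<open>m\<close> contribute, so the order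
  \<open>l + m\<close> is even and, except for \<open>l = m = 1\<close>, at least 4.\<close>

lemma fay_H_term:
  assumes "reducible n V w" "i + j < w \<or> i + j = w \<and> (l, m) \<noteq> (1, 1)"
  shows "(\<lambda>v. qconst (H_coeff l * H_coeff m)
      * cpow l i (cpow m j v)) \<in> jet_polys n V (i + j) 0"
proof (cases "odd l \<and> odd m")
  case True
  have "(\<lambda>v. cpow l i (cpow m j v)) \<in> jets (l + (m + 0)) (i + (j + 0))"
    by (intro jets_cpow jets_id)
  moreover have "l + m \<ge> 2" using True by (auto elim!: oddE)
  moreover have "i + j = w \<Longrightarrow> l + m \<ge> 4" using True assms(2) by (auto elim!: oddE)
  ultimately show ?thesis
    using True assms by (intro jet_polys_scale jets_jet_polys[OF assms(1), of _ "l + m"]) auto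
next
  case False
  then have "H_coeff l * H_coeff m = 0"
    by (auto simp: H_coeff_even)
  then show ?thesis by (simp only: of_rat_0 mconst_0 mult_zero_left jet_polys_zero)
qed

lemma fay_H_jet_polys:
  assumes "reducible n V w" "i + j < w"
  shows "(\<lambda>v. fay_H (1/2) (-1/2) v $ j $ i) \<in> jet_polys n V (i + j) 0"
proof -
  have "(\<lambda>v. - (\<Sum>x\<in>{0..i} \<times> {0..j}. (case x of (l, m) \<Rightarrow>
     qconst (H_coeff l * H_coeff m) * cpow l i (cpow m j v))))
     \<in> jet_polys n V (i + j) 0"
    by (intro jet_polys_uminus jet_polys_sum) (use assms in \<open>auto split: prod.split intro!: fay_H_term simp del: of_rat_mult\<close>)
  then show ?thesis by (simp only: fay_H_expansion)
qed

text \<open>At top weight \<open>l = m = 1\<close> is the one summand that \<open>reducible\<close>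
  does not cover; it is split off.\<close>

lemma fay_H_jet_polys_top:
  assumes "reducible n V (i + j)" "i \<ge> 1" "j \<ge> 1"
  shows "(\<lambda>v. fay_H (1/2) (-1/2) v $ j $ i + cpow 1 i (cpow 1 j v)) \<in> jet_polys n V (i + j) 0"
proof -
  let ?t = "\<lambda>v x. (case x of (l, m) \<Rightarrow>
     qconst (H_coeff l * H_coeff m) * cpow l i (cpow m j v))"
  have "(\<lambda>v. - (\<Sum>x\<in>{0..i} \<times> {0..j} - {(1, 1)}. ?t v x)) \<in> jet_polys n V (i + j) 0"
    by (intro jet_polys_uminus jet_polys_sum) (use assms in \<open>auto split: prod.split intro!: fay_H_term simp del: of_rat_mult\<close>)
  moreover have "(\<Sum>x\<in>{0..i} \<times> {0..j}. ?t v x) = cpow 1 i (cpow 1 j v) + (\<Sum>x\<in>{0..i} \<times> {0..j} - {(1, 1)}. ?t v x)" for v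
    by (subst sum.remove[of _ "(1, 1)"]) (use assms in \<open>simp_all add: H_coeff_1 del: cpow.simps\<close>)
  ultimately show ?thesis unfolding fay_H_expansion by (simp del: cpow.simps)
qed

lemma fay_Q_expansion:
  "fay_Q (1/2) (-1/2) v p q = (\<Sum>(l, m)\<in>{0..p} \<times> {0..q}.
     qconst (Q_coeff l m) * cpow l p (cpow m q (pd 1 v)))"
proof -
  have cpow_sum: "cpow l i (\<Sum>x\<in>A. f x) = (\<Sum>x\<in>A. cpow l i (f x))" for l i f and A :: "nat set"
    by (induction A rule: infinite_finite_induct) (simp_all add: cpow_add)
  have S: "shift a p (shift b q f) = (\<Sum>l=0..p. \<Sum>m=0..q. mconst (a ^ l * b ^ m / (fact l * fact m)) * cpow l p (cpow m q f))"
    for a b f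
    by (simp add: shift_def cpow_sum cpow_mconst_mult sum_distrib_left mult.assoc[symmetric] mconst_mult[symmetric])
  have "fay_Q (1/2) (-1/2) v p q = (\<Sum>l=0..p. \<Sum>m=0..q.
     qconst (Q_coeff l m) * cpow l p (cpow m q (pd 1 v)))"
    unfolding fay_Q_def S sum_subtractf[symmetric] left_diff_distrib[symmetric]
    by (simp only: of_rat_Q_coeff mconst_diff)
  then show ?thesis by (simp add: sum.cartesian_product)
qed

text \<open>An odd \<open>l + m\<close> and the extra \<open>\<partial>\<close> give an even order.
  Order two means \<open>l + m = 1\<close>, and then the trivial power \<open>cpow 0\<close> kills
  the term by the last two hypotheses.\<close>

lemma fay_Q_term:
  assumes "reducible n V w" "p + q + 1 = w" "l = 0 \<and> m = 1 \<longrightarrow> p > 0" "l = 1 \<and> m = 0 \<longrightarrow> q > 0"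
  shows "(\<lambda>v. qconst (Q_coeff l m)
      * cpow l p (cpow m q (pd 1 v))) \<in> jet_polys n V w 0"
proof -
  consider "even (l + m)" | "l + m = 1" | "odd (l + m)" "l + m \<ge> 3"
  proof -
    have "even (l + m) \<or> l + m = 1 \<or> odd (l + m) \<and> l + m \<ge> 3" by presburger
    with that show thesis by blast
  qed
  then show ?thesis
  proof cases
    case 1
    then show ?thesis by (simp add: Q_coeff_even jet_polys_zero)
  next
    case 2
    then have "l = 0 \<and> m = 1 \<or> l = 1 \<and> m = 0" by auto
    then have "cpow l p (cpow m q (pd 1 v)) = 0" for v
      using assms(3,4) by auto
    then show ?thesis by (simp add: jet_polys_zero)
  next
    case 3
    have "(\<lambda>v. cpow l p (cpow m q (pd 1 v))) \<in> jets (l + (m + Suc 0)) (p + (q + (1 + 0)))"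
      by (intro jets_cpow jets_pd jets_id) simp
    with 3 assms show ?thesis
      by (intro jet_polys_scale jets_jet_polys[OF assms(1), of _ "l + m + 1"]) auto
  qed
qed

text \<open>Since \<open>j \<ge> 1\<close>, the second index of \<open>fay_Q\<close> is positive
  throughout, so an order two term arises only for \<open>p = 0\<close>, with the sign of
  \<open>Q_coeff 0 1\<close>.\<close>

lemma fay_X_jet_polys:
  assumes "reducible n V (i + j)" "i \<ge> 1" "j \<ge> 1"
  shows "(\<lambda>v. fay_X (1/2) (-1/2) v $ j $ i + cpow 1 (i + j - 1) (pd 1 v)) \<in> jet_polys n V (i + j) 0"
proof -
  let ?t = "\<lambda>p q v x. (case x of (l, m) \<Rightarrow>
     qconst (Q_coeff l m) * cpow l p (cpow m q (pd 1 v)))"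
  define s where "s = i + j - 1"
  have Q: "(\<lambda>v. fay_Q (1/2) (-1/2) v p (s - p)) \<in> jet_polys n V (i + j) 0" if "1 \<le> p" "p < i" for p
    unfolding fay_Q_expansion
  proof (intro jet_polys_sum)
    fix x assume "x \<in> {0..p} \<times> {0..s - p}"
    show "(\<lambda>v. ?t p (s - p) v x) \<in> jet_polys n V (i + j) 0"
      by (cases x, simp only: prod.case, rule fay_Q_term[OF assms(1)])
         (use assms that in \<open>auto simp: s_def\<close>)
  qed
  have "(\<lambda>v. \<Sum>x\<in>{0..0} \<times> {0..s} - {(0, 1)}. ?t 0 s v x) \<in> jet_polys n V (i + j) 0"
  proof (intro jet_polys_sum)
    fix x assume "x \<in> {0..0} \<times> {0..s} - {(0 :: nat, 1)}"
    then show "(\<lambda>v. ?t 0 s v x) \<in> jet_polys n V (i + j) 0"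
      by (cases x, simp only: prod.case, intro fay_Q_term[OF assms(1)])
         (use assms in \<open>auto simp: s_def\<close>)
  qed
  moreover have "fay_Q (1/2) (-1/2) v 0 s + cpow 1 s (pd 1 v) = (\<Sum>x\<in>{0..0} \<times> {0..s} - {(0, 1)}. ?t 0 s v x)" for v
    unfolding fay_Q_expansion
    by (subst sum.remove[of _ "(0, 1)"]) (use assms in \<open>simp_all add: s_def Q_coeff_0_1 of_rat_minus mconst_uminus del: cpow.simps(2)\<close>)
  ultimately have Q0: "(\<lambda>v. fay_Q (1/2) (-1/2) v 0 s + cpow 1 s (pd 1 v)) \<in> jet_polys n V (i + j) 0"
    by simp
  have "(\<lambda>v. (fay_Q (1/2) (-1/2) v 0 s + cpow 1 s (pd 1 v)) + (\<Sum>p=1..<i. fay_Q (1/2) (-1/2) v p (s - p)))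
      \<in> jet_polys n V (i + j) 0"
    by (intro jet_polys_add jet_polys_sum Q0 Q) auto
  moreover have "fay_X (1/2) (-1/2) v $ j $ i = fay_Q (1/2) (-1/2) v 0 s + (\<Sum>p=1..<i. fay_Q (1/2) (-1/2) v p (s - p))" for v
  proof -
    have "{..<i} = insert 0 {1..<i}" using assms by auto
    then show ?thesis by (simp add: fay_X_nth s_def)
  qed
  ultimately show ?thesis by (simp add: s_def add.assoc add.left_commute add.commute del: cpow.simps)
qed

text \<open>\<open>fay_H\<close> has no terms of degree 0 in \<open>y\<close> or \<open>z\<close>.
  Hence every factor of a product of at least two has weight below \<open>w\<close>.\<close>

lemma fay_H_power_jet_polys:
  assumes "reducible n V w" "l \<ge> 1 \<and> i + j < w \<or> l \<ge> 2 \<and> i + j = w"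
  shows "(\<lambda>v. (fay_H (1/2) (-1/2) v ^ l) $ j $ i) \<in> jet_polys n V (i + j) 0"
  using assms(2)
proof (induction l arbitrary: i j)
  case (Suc l)
  let ?H = "\<lambda>v. fay_H (1/2) (-1/2) v"
  show ?case
  proof (cases "l = 0")
    case True
    then show ?thesis using Suc.prems fay_H_jet_polys[OF assms(1)] by simp
  next
    case False
    have "(\<lambda>v. \<Sum>b=0..j. \<Sum>a=0..i. ?H v $ b $ a * (?H v ^ l) $ (j - b) $ (i - a)) \<in> jet_polys n V (i + j) 0"
    proof (intro jet_polys_sum)
      fix b a assume ab: "b \<in> {0..j}" "a \<in> {0..i}"
      consider "a = 0 \<or> b = 0" | "a + b = w" "j - b = 0" | "a \<ge> 1" "b \<ge> 1" "a + b < w"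
        using ab Suc.prems by fastforce
      then show "(\<lambda>v. ?H v $ b $ a * (?H v ^ l) $ (j - b) $ (i - a)) \<in> jet_polys n V (i + j) 0"
      proof cases
        case 3
        have "(\<lambda>v. ?H v $ b $ a * (?H v ^ l) $ (j - b) $ (i - a))
            \<in> jet_polys n V ((a + b) + ((i - a) + (j - b))) (0 + 0)"
          by (intro jet_polys_mult fay_H_jet_polys[OF assms(1)] Suc.IH) (use 3 ab Suc.prems False in auto)
        moreover have "(a + b) + ((i - a) + (j - b)) = i + j" using ab by auto
        ultimately show ?thesis by simp
      qed (use False in \<open>auto simp: jet_polys_zero startsby_zero_power\<close>)
    qed
    then show ?thesis by (simp add: fps_mult_nth fps_sum_nth)
  qed
qed simp

text \<open>The free bound \<open>N\<close> allows one common truncation for the coefficients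
  \<open>(i, j)\<close> and \<open>(j, i)\<close>.\<close>

lemma fexp_fay_H_nth:
  assumes "j \<le> N"
  shows "ec2.fexp (fay_H a b v) $ j $ i = (\<Sum>l=0..N. exp_coeff l * (fay_H a b v ^ l) $ j $ i)"
  using ec2.fexp_nth[OF fay_H_nth_0 assms] by (simp add: fps_sum_nth)

lemma fexp_fay_H_jet_polys:
  assumes "reducible n V (i + j)" "j \<ge> 1"
  shows "(\<lambda>v. ec2.fexp (fay_H (1/2) (-1/2) v) $ j $ i - fay_H (1/2) (-1/2) v $ j $ i)
      \<in> jet_polys n V (i + j) 0"
proof -
  have "(\<lambda>v. \<Sum>l=2..j. qconst (1 / fact l) * (fay_H (1/2) (-1/2) v ^ l) $ j $ i) \<in> jet_polys n V (i + j) 0"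
    by (intro jet_polys_sum jet_polys_scale fay_H_power_jet_polys[OF assms(1)]) auto
  moreover have "ec2.fexp (fay_H (1/2) (-1/2) v) $ j $ i
      = fay_H (1/2) (-1/2) v $ j $ i + (\<Sum>l=2..j. qconst (1 / fact l) * (fay_H (1/2) (-1/2) v ^ l) $ j $ i)" for v
  proof -
    have "{0..j} = insert 0 (insert 1 {2..j})" using assms(2) by auto
    then show ?thesis
      unfolding fexp_fay_H_nth[OF order_refl] using assms(2) by (simp add: exp_coeff_qconst)
  qed
  ultimately show ?thesis by simp
qed

section \<open>The Fay identity coefficient by coefficient\<close>

definition fay_eq :: "nat \<Rightarrow> nat \<Rightarrow> complex mvps \<Rightarrow> bool" where
  "fay_eq i j v \<longleftrightarrow> ec2.fexp (fay_H (1/2) (-1/2) v) $ j $ i = fay_X (1/2) (-1/2) v $ j $ i"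

lemma fay_H_power_nth_0: "l > 0 \<Longrightarrow> (fay_H a b v ^ l) $ j $ 0 = 0"
  by (cases l) (simp_all add: fps_mult_nth fps_sum_nth)

lemma fay_iff_fay_eq: "fay (1/2) (-1/2) v \<longleftrightarrow> (\<forall>i\<ge>1. \<forall>j\<ge>1. fay_eq i j v)"
proof
  assume "fay (1/2) (-1/2) v"
  then show "\<forall>i\<ge>1. \<forall>j\<ge>1. fay_eq i j v" by (simp add: fay_def fay_eq_def)
next
  assume eq: "\<forall>i\<ge>1. \<forall>j\<ge>1. fay_eq i j v"
  show "fay (1/2) (-1/2) v"
    unfolding fay_def
  proof (rule fps_ext, rule fps_ext)
    fix j i :: nat
    consider "j = 0" | "i = 0" "j > 0" | "i \<ge> 1" "j \<ge> 1"
    proof -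
      have "j = 0 \<or> i = 0 \<and> j > 0 \<or> i \<ge> 1 \<and> j \<ge> 1" by auto
      with that show thesis by blast
    qed
    then show "ec2.fexp (fay_H (1/2) (-1/2) v) $ j $ i = (1 + fay_X (1/2) (-1/2) v) $ j $ i"
    proof cases
      case 1
      then show ?thesis using fay_Q_sum_0[of "1/2" "-1/2" v i] by (simp add: fay_X_nth)
    next
      case 2
      have "(\<Sum>l=0..j. exp_coeff l * (fay_H (1/2) (-1/2) v ^ l) $ j $ 0) = 0"
      proof (rule sum.neutral, rule ballI)
        fix l
        show "exp_coeff l * (fay_H (1/2) (-1/2) v ^ l) $ j $ 0 = 0"
          using 2 fay_H_power_nth_0[of l] by (cases "l = 0") simp_all
      qed
      with 2 show ?thesis by (simp add: fexp_fay_H_nth[OF order_refl] fay_X_nth)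
    qed (use eq in \<open>simp add: fay_eq_def\<close>)
  qed
qed

lemma fay_eq_sym: "fay_eq i j v \<longleftrightarrow> fay_eq j i v"
proof -
  let ?H = "fay_H (1/2) (-1/2) v"
  have pow: "(?H ^ l) $ j $ i = (?H ^ l) $ i $ j" for l i j
  proof (induction l arbitrary: i j)
    case (Suc l)
    have "(?H ^ Suc l) $ j $ i = (\<Sum>b=0..j. \<Sum>a=0..i. ?H $ b $ a * (?H ^ l) $ (j - b) $ (i - a))"
      by (simp add: fps_mult_nth fps_sum_nth)
    also have "\<dots> = (\<Sum>a=0..i. \<Sum>b=0..j. ?H $ a $ b * (?H ^ l) $ (i - a) $ (j - b))"
      by (subst sum.swap) (intro sum.cong refl arg_cong2[where f = "(*)"] fay_H_sym Suc)
    also have "\<dots> = (?H ^ Suc l) $ i $ j"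
      by (simp add: fps_mult_nth fps_sum_nth)
    finally show ?case .
  qed auto
  have "ec2.fexp ?H $ j $ i = ec2.fexp ?H $ i $ j"
    unfolding fexp_fay_H_nth[OF le_add1[of i j]] fexp_fay_H_nth[OF le_add2[of j i]] by (simp only: pow[of _ i j])
  then show ?thesis by (simp add: fay_eq_def fay_X_sym[of _ _ _ i])
qed

text \<open>Powers of \<open>fay_H\<close> beyond the first start at inner degree 2. In the linear
  term the shift of index 1 is a multiple of \<open>\<partial>\<close>, and the two halves add up to
  \<open>fay_X\<close>.\<close>

lemma fay_eq_1: "j \<ge> 1 \<Longrightarrow> fay_eq 1 j v"
proof -
  assume j: "j \<ge> 1"
  let ?H = "fay_H (1/2) (-1/2) v"
  have sh: "shift a 1 f = mconst a * pd 1 f" for a f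
    using shift_rec[of 1 a f] by simp
  have "ec2.fexp ?H $ j $ 1 = (\<Sum>l=0..j. exp_coeff l * (?H ^ l) $ j $ 1)"
    by (rule fexp_fay_H_nth) simp
  also have "\<dots> = (\<Sum>l\<in>{1}. exp_coeff l * (?H ^ l) $ j $ 1)"
  proof (rule sum.mono_neutral_right)
    show "\<forall>l\<in>{0..j} - {1}. exp_coeff l * (?H ^ l) $ j $ 1 = 0"
    proof
      fix l assume l: "l \<in> {0..j} - {1}"
      show "exp_coeff l * (?H ^ l) $ j $ 1 = 0"
      proof (cases "l = 0")
        case False
        with l have l2: "l - 1 > 0" by auto
        have "(?H ^ Suc (l - 1)) $ j $ 1 = 0"
          using fay_H_power_nth_0[OF l2] by (simp add: fps_mult_nth fps_sum_nth)
        then show ?thesis using False by simp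
      qed (use j in simp)
    qed
  qed (use j in auto)
  also have "\<dots> = ?H $ j $ 1" by (simp add: exp_coeff_def)
  also have "\<dots> = fay_X (1/2) (-1/2) v $ j $ 1"
  proof -
    have half: "mconst (1/2) * f + mconst (1/2) * f = f" for f :: "complex mvps"
      by (simp flip: distrib_right mconst_add)
    have "?H $ j $ 1 = - (mconst (1/2) * (pd 1 (shift (1/2) j v) - pd 1 (shift (-1/2) j v))
        + mconst (1/2) * (pd 1 (shift (1/2) j v) - pd 1 (shift (-1/2) j v)))"
      unfolding fay_H_nth sh by (simp add: mconst_uminus algebra_simps)
    also have "\<dots> = pd 1 (shift (-1/2) j v) - pd 1 (shift (1/2) j v)"
      unfolding half by simp
    finally show ?thesis by (simp add: fay_X_nth fay_Q_def pd_shift)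
  qed
  finally show ?thesis by (simp add: fay_eq_def)
qed

text \<open>Once the reducible parts are collected in \<open>r\<close>, two terms of order two
  remain, one from \<open>fay_H\<close> and one from \<open>fay_X\<close>; the factor
  \<open>i * j\<close> normalises the first.\<close>

lemma fay_eq_reduced:
  assumes "reducible n V (i + j)" "i \<ge> 1" "j \<ge> 1"
  shows "\<exists>r \<in> jet_polys n UNIV (i + j) 0. \<forall>v\<in>V. fay_eq i j v \<longleftrightarrow>
    pd i (pd j v) = qconst (of_nat (i * j) / of_nat (i + j - 1)) * pd 1 (pd (i + j - 1) v) + r v"
proof -
  define s where "s = i + j - 1"
  have s: "s \<ge> 1" using assms by (simp add: s_def)
  define h where "h = (\<lambda>v. fay_H (1/2) (-1/2) v $ j $ i + cpow 1 i (cpow 1 j v))"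
  define x where "x = (\<lambda>v. fay_X (1/2) (-1/2) v $ j $ i + cpow 1 s (pd 1 v))"
  define u where "u = (\<lambda>v. ec2.fexp (fay_H (1/2) (-1/2) v) $ j $ i - fay_H (1/2) (-1/2) v $ j $ i)"
  have "(\<lambda>v. qconst (of_nat (i * j)) * (h v - x v + u v)) \<in> jet_polys n V (i + j) 0"
    unfolding h_def x_def u_def s_def
    by (intro jet_polys_scale jet_polys_add[OF jet_polys_diff[OF fay_H_jet_polys_top[OF assms]
            fay_X_jet_polys[OF assms]] fexp_fay_H_jet_polys[OF assms(1,3)]])
  \<comment> \<open>The map on the left is a differential polynomial only on \<open>V\<close>; it is
    replaced by that polynomial, which is defined for all \<open>v\<close>.\<close>
  then obtain r where r: "r \<in> qspan (jet_mono ` jet_matrices n (i + j) 0)"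
      "\<And>v. v \<in> V \<Longrightarrow> qconst (of_nat (i * j)) * (h v - x v + u v) = r v"
    unfolding jet_polys_def by blast
  have cpow1: "cpow (Suc 0) p f = mconst (1 / of_nat p) * pd p f" if "p \<ge> 1" for p f
  proof -
    have "cpow (Suc 0) p f = (\<Sum>i\<in>{p}. mconst (1 / of_nat i) * pd i (cpow 0 (p - i) f))"
      unfolding cpow.simps(2) by (rule sum.mono_neutral_right) (use that in auto)
    then show ?thesis by simp
  qed
  have "fay_eq i j v \<longleftrightarrow> pd i (pd j v) = qconst (of_nat (i * j) / of_nat s) * pd 1 (pd s v) + r v"
    if v: "v \<in> V" for v
  proof -
    have nz: "of_nat i \<noteq> (0 :: complex)" "of_nat j \<noteq> (0 :: complex)" "of_nat s \<noteq> (0 :: complex)"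
      using assms s by auto
    have "ec2.fexp (fay_H (1/2) (-1/2) v) $ j $ i - fay_X (1/2) (-1/2) v $ j $ i
        = (h v - x v + u v) + cpow 1 s (pd 1 v) - cpow 1 i (cpow 1 j v)"
      by (simp add: h_def x_def u_def del: cpow.simps)
    also have "mconst (of_nat (i * j)) * \<dots>
        = r v + mconst (of_nat (i * j)) * cpow 1 s (pd 1 v) - mconst (of_nat (i * j)) * cpow 1 i (cpow 1 j v)"
      using r(2)[OF v, unfolded of_rat_of_nat_eq] by (simp add: distrib_left right_diff_distrib del: cpow.simps of_nat_mult)
    also have "mconst (of_nat (i * j)) * cpow 1 i (cpow 1 j v) = pd i (pd j v)"
      using assms nz by (simp add: cpow1 pd_mconst_mult mult.assoc[symmetric] mconst_mult[symmetric] del: cpow.simps)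
    also have "mconst (of_nat (i * j)) * cpow 1 s (pd 1 v) = qconst (of_nat (i * j) / of_nat s) * pd 1 (pd s v)"
      using s by (simp add: cpow1 mult.assoc[symmetric] mconst_mult[symmetric] of_rat_divide of_rat_mult pd_commute[of s]
          del: cpow.simps)
    finally have *: "mconst (of_nat (i * j)) * (ec2.fexp (fay_H (1/2) (-1/2) v) $ j $ i - fay_X (1/2) (-1/2) v $ j $ i)
        = r v + qconst (of_nat (i * j) / of_nat s) * pd 1 (pd s v) - pd i (pd j v)" .
    have "fay_eq i j v \<longleftrightarrow> mconst (of_nat (i * j)) * (ec2.fexp (fay_H (1/2) (-1/2) v) $ j $ i - fay_X (1/2) (-1/2) v $ j $ i) = 0"
    proof -
      have "i * j \<noteq> 0" using assms by simp
      then have "of_nat (i * j) * f = 0 \<Longrightarrow> f = 0" for f :: "complex mvps"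
        using of_nat_mult_cancel[of "i * j" f 0] by simp
      then show ?thesis unfolding fay_eq_def mconst_of_nat by (metis mult_zero_right right_minus_eq)
    qed
    then show ?thesis unfolding * by (simp add: algebra_simps) metis
  qed
  with jet_polysI[OF r(1)] show ?thesis by (auto simp: s_def)
qed

section \<open>Reduction of the derivatives\<close>

text \<open>
  The order in which the \<open>\<partial>\<^sub>i\<^sub>1 \<cdots> \<partial>\<^sub>i\<^sub>k v\<close> are reduced: by weight, then longer indices first,
  then those of the form \<open>\<partial>\<^sub>1 \<partial>\<^sub>s v\<close>.
\<close>

definition index_order :: "(nat list \<times> nat list) set" where
  "index_order = measures [sum_list, \<lambda>is. sum_list is - length is, \<lambda>is. if 1 \<in> set is then 0 else 1]"

text \<open>Reducing on this set instead of the set of solutions lets the same computation serve the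
  converse, where being a solution is yet to be proved.\<close>

definition reduced_set :: "(nat list \<Rightarrow> complex mvps \<Rightarrow> complex mvps) \<Rightarrow> nat list \<Rightarrow> complex mvps set" where
  "reduced_set f x = {v. \<forall>y. (y, x) \<in> index_order \<and> valid_index y \<longrightarrow> pds y v = f y v}"

text \<open>
  The equation for \<open>\<partial>\<^sub>1 \<partial>\<^sub>j v\<close> with \<open>j > n\<close> is what remains of the Fay identity for
  \<open>\<partial>\<^sub>n \<partial>\<^sub>j\<^sub>-\<^sub>n\<^sub>+\<^sub>1 v\<close> when the latter vanishes.
\<close>

definition pair_eqs :: "nat \<Rightarrow> nat list \<Rightarrow> complex mvps \<Rightarrow> bool" where
  "pair_eqs n x v \<longleftrightarrow> (\<forall>i j. x = [i, j] \<longrightarrow>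
     (i = n \<or> j = n \<longrightarrow> pd i (pd j v) = 0) \<and>
     (i \<ge> 2 \<and> j \<ge> 2 \<and> i \<noteq> n \<and> j \<noteq> n \<longrightarrow> fay_eq i j v) \<and>
     (i = 1 \<and> j > n \<and> pd n (pd (j - n + 1) v) = 0 \<longrightarrow> fay_eq n (j - n + 1) v))"

text \<open>The last clause carries the converse through the recursion: the prescribed values have
  to imply the hierarchy.\<close>

definition good_reduction ::
  "nat \<Rightarrow> (nat list \<Rightarrow> complex mvps \<Rightarrow> complex mvps) \<Rightarrow> nat list \<Rightarrow> (complex mvps \<Rightarrow> complex mvps) \<Rightarrow> bool" where
  "good_reduction n f x r \<longleftrightarrow> (valid_index x \<longrightarrow>
     r \<in> qspan (jet_mono ` jet_matrices n (sum_list x) (length x - 2)) \<and>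
     (\<forall>v. GD_solution n v \<longrightarrow> pds x v = r v) \<and>
     (\<forall>v \<in> reduced_set f x. pds x v = r v \<longrightarrow> pair_eqs n x v))"

lemma length_le_sum_list_valid: "valid_index x \<Longrightarrow> length x \<le> sum_list x"
  using length_le_sum_list by (auto simp: valid_index_def)

text \<open>Orders above two are reached by differentiation. Among pairs, those containing
  \<open>n\<close> reduce to 0, \<open>\<partial> \<partial>_s v\<close> with \<open>s < n\<close>
  is basic, \<open>s > n\<close> is solved from the Fay coefficient of a vanishing derivative, and
  any other pair is led to one containing 1.\<close>

lemma good_reduction_exists:
  assumes n: "n \<ge> 2" and f: "\<And>y. (y, x) \<in> index_order \<Longrightarrow> good_reduction n f y (f y)"
  shows "\<exists>r. good_reduction n f x r"
proof (cases "valid_index x")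
  case x: True
  let ?V = "reduced_set f x"
  have GD: "v \<in> ?V" if "GD_solution n v" for v
    using f that by (auto simp: reduced_set_def good_reduction_def)
  have below: "pds y \<in> jet_polys n ?V (sum_list y) (length y - 2)"
    if "(y, x) \<in> index_order" "valid_index y" for y
  proof (rule jet_polys_cong)
    show "f y \<in> jet_polys n ?V (sum_list y) (length y - 2)"
      using f[OF that(1)] that(2) by (intro jet_polysI) (auto simp: good_reduction_def)
    show "pds y v = f y v" if "v \<in> ?V" for v
      using that \<open>(y, x) \<in> index_order\<close> \<open>valid_index y\<close> by (auto simp: reduced_set_def)
  qed
  have lower: "(y, x) \<in> index_order" if "sum_list y < sum_list x" for y
    using that by (simp add: index_order_def)
  show ?thesis
  proof (cases "length x \<ge> 3")
    case True
    \<comment> \<open>Strip off one index and differentiate the reduction of the rest; the pairs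
      \<open>[c, s]\<close> met on the way have lower weight than \<open>x\<close> because
      \<open>t \<ge> 1\<close>.\<close>
    then obtain c x' where c: "x = c # x'" by (cases x) auto
    with x True have x': "valid_index x'" "c \<ge> 1" by (auto simp: valid_index_def)
    have "pds x' \<in> jet_polys n ?V (sum_list x') (length x' - 2)"
      by (rule below[OF lower]) (use x' c in auto)
    then have "(\<lambda>v. pd c (pds x' v)) \<in> jet_polys n ?V (c + sum_list x') (length x' - 2 + 1)"
    proof (rule jet_polys_pd)
      fix s t :: nat assume st: "1 \<le> s" "s < n" "1 \<le> t" "s + t \<le> sum_list x'"
      have "pds [c, s] \<in> jet_polys n ?V (sum_list [c, s]) (length [c, s] - 2)"
        by (rule below[OF lower]) (use x' c st in \<open>auto simp: valid_index_def\<close>)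
      from jet_polys_pd_1[OF this, of t]
      show "(\<lambda>v. pd c (pd s ((pd 1 ^^ t) v))) \<in> jet_polys n ?V (c + s + t) t"
        by (simp add: pd_funpow_commute)
    qed
    moreover have "sum_list x = c + sum_list x'" "length x - 2 = length x' - 2 + 1"
      using x' by (auto simp: c valid_index_def)
    ultimately have "pds x \<in> jet_polys n ?V (sum_list x) (length x - 2)"
      by (simp only: c pds_Cons[abs_def])
    then obtain r where r: "r \<in> qspan (jet_mono ` jet_matrices n (sum_list x) (length x - 2))"
        "\<forall>v\<in>?V. pds x v = r v"
      unfolding jet_polys_def by blast
    have "pair_eqs n x v" for v using True by (auto simp: pair_eqs_def)
    with r GD show ?thesis unfolding good_reduction_def by blast
  next
    case False
    with x have "length x = 2" by (auto simp: valid_index_def)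
    then obtain i j where "x = [i, j]" by (auto simp: numeral_2_eq_2 length_Suc_conv)
    with x have ij: "x = [i, j]" "i \<ge> 1" "j \<ge> 1" by (auto simp: valid_index_def)
    have GD0: "pd n (pd m v) = 0" if "GD_solution n v" "m \<ge> 1" for v m
      using that by (auto simp: GD_solution_iff_fay)
    have GD_fay: "fay_eq p q v" if "GD_solution n v" "p \<ge> 1" "q \<ge> 1" for v p q
      using that unfolding GD_solution_iff_fay fay_iff_fay_eq by blast
    have red: "reducible n ?V (i + j)"
      unfolding reducible_def
    proof (intro allI impI, elim conjE)
      fix y assume y: "valid_index y" "sum_list y < i + j \<or> sum_list y = i + j \<and> length y \<ge> 3"
      \<comment> \<open>At equal weight the longer index comes first; its length does not exceed its
        sum, so the truncated difference really decreases.\<close>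
      have "(y, x) \<in> index_order"
        using y length_le_sum_list_valid[OF y(1)] by (auto simp: index_order_def ij)
      then show "pds y \<in> jet_polys n ?V (sum_list y) (length y - 2)"
        using y by (intro below)
    qed
    have len: "sum_list x = i + j" "length x - 2 = 0" "\<And>v. pds x v = pd i (pd j v)"
      using ij by auto
    consider "i = n \<or> j = n"
      | s where "i \<noteq> n" "j \<noteq> n" "x = [1, s] \<or> x = [s, 1]" "s < n"
      | s where "i \<noteq> n" "j \<noteq> n" "x = [1, s] \<or> x = [s, 1]" "s > n"
      | "i \<ge> 2" "j \<ge> 2" "i \<noteq> n" "j \<noteq> n"
    proof -
      have "i = n \<or> j = n \<or> (i = 1 \<or> j = 1) \<and> i \<noteq> n \<and> j \<noteq> n \<or> i \<ge> 2 \<and> j \<ge> 2 \<and> i \<noteq> n \<and> j \<noteq> n"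
        using ij by auto
      with that ij(1) show thesis by (metis linorder_neqE_nat)
    qed
    then show ?thesis
    proof cases
      case 1
      have "pd i (pd j v) = 0" if "GD_solution n v" for v
        using 1 GD0[OF that] ij pd_commute[of i j v] by metis
      moreover have "pair_eqs n x v" if "pd i (pd j v) = 0" for v
        using that 1 n by (auto simp: pair_eqs_def ij)
      ultimately have "good_reduction n f x (\<lambda>v. 0)"
        unfolding good_reduction_def len by (auto intro: qspan.zero)
      then show ?thesis by blast
    next
      case 2
      have "[(s, 1)] \<in> jet_matrices n (sum_list x) (length x - 2)"
        using 2 ij by (auto simp: jet_matrices_def excess_def)
      moreover have "pds x v = jet_mono [(s, 1)] v" for v
        using 2 by (auto simp: pd_commute[of s])
      moreover have "pair_eqs n x v" for v
        using 2 n ij by (auto simp: pair_eqs_def)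
      ultimately have "good_reduction n f x (jet_mono [(s, 1)])"
        unfolding good_reduction_def by (auto intro: qspan_base)
      then show ?thesis by blast
    next
      case 3
      \<comment> \<open>Chosen so that \<open>n + m - 1 = s\<close>: the Fay coefficient
        \<open>(n, m)\<close> contains \<open>\<partial> \<partial>_s v\<close> with factor
        \<open>K \<noteq> 0\<close>, while \<open>\<partial>_n \<partial>_m v\<close> vanishes on
        solutions.\<close>
      define m where "m = s - n + 1"
      define K :: rat where "K = of_nat (n * m) / of_nat s"
      have m: "m \<ge> 2" "n + m = i + j" "n + m - 1 = s" using 3 ij by (auto simp: m_def)
      have K: "K \<noteq> 0" using n m 3 by (simp add: K_def)
      from red have "reducible n ?V (n + m)" by (simp only: m)
      from fay_eq_reduced[OF this] n m obtain r where r: "r \<in> jet_polys n UNIV (i + j) 0"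
          "\<And>v. v \<in> ?V \<Longrightarrow> fay_eq n m v \<longleftrightarrow> pd n (pd m v) = qconst K * pd 1 (pd s v) + r v"
        unfolding K_def by (auto simp del: of_rat_divide)
      have xs: "pds x v = pd 1 (pd s v)" for v
        using 3 by (auto simp: pd_commute[of s])
      have eq: "qconst K * pd 1 (pd s v) + r v = 0 \<longleftrightarrow> pds x v = qconst (- 1 / K) * r v" for v
      proof -
        have "pds x v = qconst (1 / K) * (qconst K * pds x v)"
          using K by (simp add: mult.assoc[symmetric] qconst_mult[symmetric] del: of_rat_divide of_rat_mult)
        moreover have "qconst K * (qconst (- 1 / K) * r v) = - r v"
          using K by (simp add: mult.assoc[symmetric] qconst_mult[symmetric] of_rat_minus mconst_uminus
              del: of_rat_divide of_rat_mult)
        moreover have "qconst (- 1 / K) * r v = qconst (1 / K) * (- r v)"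
          by (simp add: of_rat_divide of_rat_minus mconst_uminus)
        ultimately show ?thesis unfolding xs by (metis add_eq_0_iff2 add.commute)
      qed
      have "(\<lambda>v. qconst (- 1 / K) * r v) \<in> jet_polys n UNIV (sum_list x) (length x - 2)"
        unfolding len using r(1) by (rule jet_polys_scale)
      \<comment> \<open>Agreement on \<open>UNIV\<close> is equality of maps, so the map itself lies
        in the span.\<close>
      then have "(\<lambda>v. qconst (- 1 / K) * r v) \<in> qspan (jet_mono ` jet_matrices n (sum_list x) (length x - 2))"
        unfolding jet_polys_def by (auto simp: fun_eq_iff[symmetric])
      moreover have "pds x v = qconst (- 1 / K) * r v" if "GD_solution n v" for v
        unfolding eq[symmetric]
        using r(2)[OF GD[OF that]] GD_fay[OF that, of n m] GD0[OF that, of m] n m by simp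
      moreover have "pair_eqs n x v" if "v \<in> ?V" "pds x v = qconst (- 1 / K) * r v" for v
      proof -
        have "pd n (pd m v) = 0 \<Longrightarrow> fay_eq n m v"
          using r(2)[OF that(1)] that(2)[folded eq] by simp
        then show ?thesis using 3 n ij by (auto simp: pair_eqs_def m_def)
      qed
      ultimately have "good_reduction n f x (\<lambda>v. qconst (- 1 / K) * r v)"
        unfolding good_reduction_def by blast
      then show ?thesis by blast
    next
      case 4
      \<comment> \<open>Of the same weight and length as \<open>x\<close>, but containing 1; it
        therefore precedes \<open>x\<close>, and its reduction can be inserted.\<close>
      let ?y = "[1, i + j - 1]"
      define K :: rat where "K = of_nat (i * j) / of_nat (i + j - 1)"
      from fay_eq_reduced[OF red] ij obtain r where r: "r \<in> jet_polys n UNIV (i + j) 0"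
          "\<And>v. v \<in> ?V \<Longrightarrow> fay_eq i j v \<longleftrightarrow> pd i (pd j v) = qconst K * pd 1 (pd (i + j - 1) v) + r v"
        unfolding K_def by (auto simp del: of_rat_divide)
      have y: "(?y, x) \<in> index_order" "valid_index ?y"
        using 4 by (auto simp: index_order_def ij(1) valid_index_def)
      have fy: "f ?y v = pd 1 (pd (i + j - 1) v)" if "v \<in> ?V" for v
        using that y by (auto simp: reduced_set_def)
      have "f ?y \<in> jet_polys n UNIV (i + j) 0"
        using f[OF y(1)] y(2) ij by (intro jet_polysI) (auto simp: good_reduction_def)
      then have "(\<lambda>v. qconst K * f ?y v + r v) \<in> jet_polys n UNIV (i + j) 0"
        using r(1) by (intro jet_polys_add jet_polys_scale)
      then have "(\<lambda>v. qconst K * f ?y v + r v) \<in> qspan (jet_mono ` jet_matrices n (sum_list x) (length x - 2))"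
        unfolding jet_polys_def len by (auto simp: fun_eq_iff[symmetric])
      moreover have "pds x v = qconst K * f ?y v + r v" if "GD_solution n v" for v
        using r(2)[OF GD[OF that]] GD_fay[OF that ij(2,3)] fy[OF GD[OF that]] by (simp add: len)
      moreover have "pair_eqs n x v" if "v \<in> ?V" "pds x v = qconst K * f ?y v + r v" for v
        using r(2)[OF that(1)] fy[OF that(1)] that(2) 4 by (auto simp: pair_eqs_def ij(1))
      ultimately have "good_reduction n f x (\<lambda>v. qconst K * f ?y v + r v)"
        unfolding good_reduction_def by blast
      then show ?thesis by blast
    qed
  qed
qed (simp add: good_reduction_def)

text \<open>Fay coefficients with an index 1 hold identically, those with an index \<open>n\<close>
  are encoded at \<open>[1, n + j - 1]\<close>, and all others at \<open>[i, j]\<close>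
  itself.\<close>

lemma pair_eqs_imp_GD_solution:
  assumes n: "n \<ge> 2" and eqs: "\<And>x. valid_index x \<Longrightarrow> pair_eqs n x v"
  shows "GD_solution n v"
proof -
  have pair: "pair_eqs n [i, j] v" if "i \<ge> 1" "j \<ge> 1" for i j
    using that by (intro eqs) (auto simp: valid_index_def)
  have zero: "pd n (pd m v) = 0" if "m \<ge> 1" for m
    using pair[of n m] that n by (auto simp: pair_eqs_def)
  have fay_n: "fay_eq n j v" if "j \<ge> 2" for j
  proof -
    have "n + j - 1 > n" "n + j - 1 - n + 1 = j" using that by auto
    then show ?thesis using pair[of 1 "n + j - 1"] zero[of j] that by (auto simp: pair_eqs_def)
  qed
  have "fay_eq i j v" if "i \<ge> 1" "j \<ge> 1" for i j
  proof (cases "i = 1 \<or> j = 1")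
    case True
    then show ?thesis using fay_eq_1[of _ v] fay_eq_sym[of 1 _ v] that by blast
  next
    case False
    with that have "i \<ge> 2" "j \<ge> 2" by auto
    then show ?thesis
      using fay_n[of i] fay_n[of j] fay_eq_sym[of n i v] pair[OF that] by (auto simp: pair_eqs_def)
  qed
  with zero show ?thesis unfolding GD_solution_iff_fay fay_iff_fay_eq by blast
qed

lemma jet_reduction_exists:
  assumes n: "n \<ge> 2"
  obtains f where "\<And>x. good_reduction n f x (f x)"
proof -
  have "\<exists>f. \<forall>x. good_reduction n f x (f x)"
  proof (rule dependent_wf_choice)
    show "wf index_order" by (simp add: index_order_def)
    \<comment> \<open>\<open>reduced_set f x\<close> consults \<open>f\<close> only below
      \<open>x\<close>, as well-founded choice demands.\<close>
    show "good_reduction n f x r = good_reduction n g x r"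
      if "\<And>z. (z, x) \<in> index_order \<Longrightarrow> f z = g z" for f g x r
    proof -
      have "reduced_set f x = reduced_set g x" using that by (auto simp: reduced_set_def)
      then show ?thesis by (simp add: good_reduction_def)
    qed
  qed (rule good_reduction_exists[OF n])
  with that show ?thesis by blast
qed

theorem theorem5p1:
  fixes n :: nat
  assumes "n \<ge> 2"
  shows "\<exists>N :: nat list \<Rightarrow> (nat \<times> nat) list \<Rightarrow> rat. \<forall>v :: complex mvps.
    GD_solution n v \<longleftrightarrow>
      (\<forall>is :: nat list. length is \<ge> 2 \<and> (\<forall>i \<in> set is. i \<ge> 1) \<longrightarrow>
        pds is v = (\<Sum>M \<in> gd_matrices n is.
          mconst (of_rat (N is M)) * (\<Prod>(s, t)\<leftarrow>M. pd s ((pd 1 ^^ t) v))))"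
proof -
  obtain f where f: "\<And>x. good_reduction n f x (f x)"
    using jet_reduction_exists[OF assms] by blast
  \<comment> \<open>The set of matrices is finite, so an element of the span has one rational
    constant per matrix, the same for all \<open>v\<close>.\<close>
  have "\<exists>N. \<forall>v. f x v = (\<Sum>M \<in> gd_matrices n x. qconst (N M) * jet_mono M v)" if "valid_index x" for x
  proof (rule qspan_image_sum)
    show "f x \<in> qspan (jet_mono ` gd_matrices n x)"
      using f[of x] that by (auto simp: good_reduction_def valid_index_def gd_matrices_eq)
  qed (rule finite_gd_matrices)
  then obtain N where N: "\<And>x v. valid_index x \<Longrightarrow>
      f x v = (\<Sum>M \<in> gd_matrices n x. qconst (N x M) * jet_mono M v)"
    by metis
  have "GD_solution n v \<longleftrightarrow> (\<forall>x. valid_index x \<longrightarrow> pds x v = f x v)" for v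
  proof
    assume "GD_solution n v"
    then show "\<forall>x. valid_index x \<longrightarrow> pds x v = f x v"
      using f by (auto simp: good_reduction_def)
  next
    assume v: "\<forall>x. valid_index x \<longrightarrow> pds x v = f x v"
    \<comment> \<open>When all equations hold, every index has its prescribed value, so the last
      clause of \<open>good_reduction\<close> applies everywhere.\<close>
    then have "v \<in> reduced_set f x" for x by (auto simp: reduced_set_def)
    with v f have "pair_eqs n x v" if "valid_index x" for x
      using that by (auto simp: good_reduction_def)
    then show "GD_solution n v" by (rule pair_eqs_imp_GD_solution[OF assms])
  qed
  then show ?thesis
    by (intro exI[of _ N] allI) (simp add: N valid_index_def jet_mono_def)
qed

end
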